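(* Let $(M,F)$ be a connected complex Finsler space of complex dimension $2$ such that $$R_{\bar rj\bar hk}=\mathcal K\,(g_{j\bar r}g_{k\bar h}+g_{k\bar r}g_{j\bar h})$$ for a real-valued function $\mathcal K=\mathcal K(z,\eta)$ on $T'M$. Then either $(M,F)$ is purely Hermitian and $\mathcal K$ is a function of $z$ alone, or $(M,F)$ is not purely Hermitian but $\mathcal K=0$.
   Context: $M$ is a complex manifold with $\dim_{\mathbb C}M=2$; $T'M$ is its holomorphic tangent bundle with local coordinates $(z^k,\eta^k)_{k=1,2}$; $\widetilde{T'M}$ is $T'M$ minus the zero section. A complex Finsler space $(M,F)$: $F:T'M\to[0,\infty)$ is continuous, $L:=F^2$ is smooth on $\widetilde{T'M}$, $F(z,\eta)=0$ iff $\eta=0$, $F(z,\lambda\eta)=|\lambda|F(z,\eta)$ for all $\lambda\in\mathbb C$, and the Hermitian matrix $g_{i\bar j}:=\partial^2L/\partial\eta^i\partial\bar\eta^j$ is positive definite on $\widetilde{T'M}$. "Connected" means $M$ is connected. Repeated indices are summed over $\{1,2\}$; all identities are on $\widetilde{T'M}$. $(g^{\bar m i})$ is the inverse matrix: $g^{\bar m i}g_{j\bar m}=\delta^i_j$. $(M,F)$ is purely Hermitian if $g_{i\bar j}=g_{i\bar j}(z)$ does not depend on $\eta$. Chern–Finsler connection: $\dot\partial_k:=\partial/\partial\eta^k$, $N^k_j:=g^{\bar mk}\frac{\partial g_{l\bar m}}{\partial z^j}\eta^l$, $\delta_k:=\frac{\partial}{\partial z^k}-N^j_k\dot\partial_j$,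 $\delta_{\bar k}:=\overline{\delta_k}$, $L^i_{jk}:=g^{\bar li}\delta_kg_{j\bar l}$, $C^i_{jk}:=g^{\bar li}\dot\partial_kg_{j\bar l}$. Curvature: $R^i_{j\bar hk}:=-\delta_{\bar h}L^i_{jk}-\delta_{\bar h}(N^l_k)C^i_{jl}$, $R_{\bar rj\bar hk}:=g_{i\bar r}R^i_{j\bar hk}$. *)

theory Defs
  imports "HOL-Analysis.Analysis"
begin

subsection \<open>Smooth and holomorphic maps\<close>

primrec Ck_on :: "nat \<Rightarrow> 'a::real_normed_vector set \<Rightarrow> ('a \<Rightarrow> 'b::real_normed_vector) \<Rightarrow> bool" where
  "Ck_on 0 S f \<longleftrightarrow> continuous_on S f"
| "Ck_on (Suc k) S f \<longleftrightarrow>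
     (\<forall>x\<in>S. f differentiable (at x)) \<and> (\<forall>v. Ck_on k S (\<lambda>x. frechet_derivative f (at x) v))"

text \<open>Only meaningful for open \<open>S\<close>.\<close>
definition smooth_on :: "'a::real_normed_vector set \<Rightarrow> ('a \<Rightarrow> 'b::real_normed_vector) \<Rightarrow> bool" where
  "smooth_on S f \<longleftrightarrow> (\<forall>k. Ck_on k S f)"

text \<open>Holomorphic maps of several variables: real differentiable with complex linear differential.\<close>
definition holomorphic_map_on :: "(complex^'n) set \<Rightarrow> (complex^'n \<Rightarrow> complex^'m) \<Rightarrow> bool" where
  "holomorphic_map_on S f \<longleftrightarrow>
     (\<forall>x\<in>S. \<exists>D. (f has_derivative D) (at x) \<and> (\<forall>a v. D (a *s v) = a *s D v))"


subsection \<open>Complex manifolds and the holomorphic tangent bundle\<close>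

type_synonym ('a, 'n) chart = "'a set \<times> ('a \<Rightarrow> complex^'n)"

definition chart_image :: "('a, 'n::finite) chart \<Rightarrow> (complex^'n) set" where
  "chart_image c = snd c ` fst c"

definition chart_inv :: "('a, 'n::finite) chart \<Rightarrow> complex^'n \<Rightarrow> 'a" where
  "chart_inv c = inv_into (fst c) (snd c)"

definition transition :: "('a, 'n::finite) chart \<Rightarrow> ('a, 'n) chart \<Rightarrow> complex^'n \<Rightarrow> complex^'n" where
  "transition c d = snd d \<circ> chart_inv c"

locale complex_manifold =
  fixes X :: "'a topology" and A :: "('a, 'n::finite) chart set"
  assumes Hausdorff: "Hausdorff_space X"
    and second_countable: "second_countable X"
    and chart_domain_open: "c \<in> A \<Longrightarrow> openin X (fst c)"
    and chart_image_open: "c \<in> A \<Longrightarrow> open (chart_image c)"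
    and chart_homeomorphic:
      "c \<in> A \<Longrightarrow> homeomorphic_map (subtopology X (fst c)) (top_of_set (chart_image c)) (snd c)"
    and charts_cover: "(\<Union>c\<in>A. fst c) = topspace X"
    and transition_holomorphic:
      "c \<in> A \<Longrightarrow> d \<in> A \<Longrightarrow> holomorphic_map_on (snd c ` (fst c \<inter> fst d)) (transition c d)"

text \<open>
  A holomorphic tangent vector at \<open>p\<close> is the family of its component vectors in all charts
  around \<open>p\<close>, related by the Jacobians of the transition maps. Entries at the irrelevant
  charts are set to 0, so that each tangent vector has a unique representation and the
  vector space operations are the pointwise ones.
\<close>
type_synonym ('a, 'n) tvec = "('a, 'n) chart \<Rightarrow> complex^'n"

definition charts_at :: "('a, 'n::finite) chart set \<Rightarrow> 'a \<Rightarrow> ('a, 'n) chart set" where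
  "charts_at A p = {c \<in> A. p \<in> fst c}"

definition hol_tangent_space :: "('a, 'n::finite) chart set \<Rightarrow> 'a \<Rightarrow> ('a, 'n) tvec set" where
  "hol_tangent_space A p =
     {v. (\<forall>c\<in>charts_at A p. \<forall>d\<in>charts_at A p.
            v d = frechet_derivative (transition c d) (at (snd c p)) (v c)) \<and>
         (\<forall>c. c \<notin> charts_at A p \<longrightarrow> v c = 0)}"

definition tvec_zero :: "('a, 'n::finite) tvec" where
  "tvec_zero = (\<lambda>c. 0)"

definition tvec_scale :: "complex \<Rightarrow> ('a, 'n::finite) tvec \<Rightarrow> ('a, 'n) tvec" where
  "tvec_scale a v = (\<lambda>c. a *s v c)"

definition hol_tangent_bundle ::
    "'a topology \<Rightarrow> ('a, 'n::finite) chart set \<Rightarrow> ('a \<times> ('a, 'n) tvec) set" where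
  "hol_tangent_bundle X A = (SIGMA p : topspace X. hol_tangent_space A p)"

definition slit_tangent_bundle ::
    "'a topology \<Rightarrow> ('a, 'n::finite) chart set \<Rightarrow> ('a \<times> ('a, 'n) tvec) set" where
  "slit_tangent_bundle X A = {(p, v) \<in> hol_tangent_bundle X A. v \<noteq> tvec_zero}"

text \<open>Natural coordinates \<open>(z, \<eta>)\<close> on the tangent bundle.\<close>
type_synonym 'n coords = "(complex^'n) \<times> (complex^'n)"

text \<open>
  The point of the tangent bundle whose natural coordinates in the chart \<open>c\<close> are \<open>(z, \<eta>)\<close>.
\<close>
definition tangent_point ::
    "('a, 'n::finite) chart set \<Rightarrow> ('a, 'n) chart \<Rightarrow> 'n coords \<Rightarrow> 'a \<times> ('a, 'n) tvec" where
  "tangent_point A c = (\<lambda>(z, \<eta>). (chart_inv c z,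
     \<lambda>d. if d \<in> charts_at A (chart_inv c z)
         then frechet_derivative (transition c d) (at z) \<eta> else 0))"

text \<open>The topology for which the natural charts of the tangent bundle are homeomorphisms.\<close>
definition tangent_topology ::
    "('a, 'n::finite) chart set \<Rightarrow> ('a \<times> ('a, 'n) tvec) topology" where
  "tangent_topology A = topology_generated_by
     {tangent_point A c ` W | c W. c \<in> A \<and> open W \<and> W \<subseteq> chart_image c \<times> UNIV}"

definition slit_coords :: "('a, 'n::finite) chart \<Rightarrow> 'n coords set" where
  "slit_coords c = chart_image c \<times> (UNIV - {0})"

lemma (in complex_manifold) inj_on_chart: "c \<in> A \<Longrightarrow> inj_on (snd c) (fst c)"
proof -
  assume c: "c \<in> A"
  have "topspace (subtopology X (fst c)) = fst c"
    using openin_subset[OF chart_domain_open[OF c]] by auto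
  then show ?thesis
    using chart_homeomorphic[OF c] homeomorphic_imp_injective_map by metis
qed

lemma (in complex_manifold) chart_inv_chart:
  "c \<in> A \<Longrightarrow> p \<in> fst c \<Longrightarrow> chart_inv c (snd c p) = p"
  by (simp add: chart_inv_def inj_on_chart)

lemma (in complex_manifold) open_chart_overlap:
  assumes c: "c \<in> A" and d: "d \<in> A"
  shows "open (snd c ` (fst c \<inter> fst d))"
proof -
  have "openin (subtopology X (fst c)) (fst c \<inter> fst d)"
    using chart_domain_open[OF d] by (auto simp: openin_subtopology)
  then have "openin (top_of_set (chart_image c)) (snd c ` (fst c \<inter> fst d))"
    using homeomorphic_imp_open_map[OF chart_homeomorphic[OF c]] by (auto simp: open_map_def)
  then show ?thesis
    using chart_image_open[OF c] openin_open_trans by blast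
qed

lemma (in complex_manifold) transition_has_derivative:
  assumes "c \<in> charts_at A p" "d \<in> charts_at A p"
  shows "(transition c d has_derivative frechet_derivative (transition c d) (at (snd c p))) (at (snd c p))"
proof -
  have "snd c p \<in> snd c ` (fst c \<inter> fst d)" using assms by (auto simp: charts_at_def)
  then have "transition c d differentiable (at (snd c p))"
    using transition_holomorphic[of c d] assms
    unfolding holomorphic_map_on_def differentiable_def charts_at_def by blast
  then show ?thesis by (simp add: frechet_derivative_works)
qed

lemma (in complex_manifold) transition_cocycle:
  assumes c: "c \<in> charts_at A p" and d: "d \<in> charts_at A p" and e: "e \<in> charts_at A p"
  shows "frechet_derivative (transition c e) (at (snd c p)) \<eta> =
         frechet_derivative (transition d e) (at (snd d p))
           (frechet_derivative (transition c d) (at (snd c p)) \<eta>)"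
proof -
  have A: "c \<in> A" "d \<in> A" "e \<in> A" and p: "p \<in> fst c" "p \<in> fst d" "p \<in> fst e"
    using assms by (auto simp: charts_at_def)
  let ?S = "snd c ` (fst c \<inter> fst d)"
  have cd: "transition c d (snd c p) = snd d p"
    by (simp add: transition_def chart_inv_chart A p)
  let ?D = "frechet_derivative (transition d e) (at (snd d p)) \<circ>
            frechet_derivative (transition c d) (at (snd c p))"
  have D: "((transition d e \<circ> transition c d) has_derivative ?D) (at (snd c p))"
    using transition_has_derivative[OF c d] transition_has_derivative[OF d e]
    by (intro diff_chain_at) (simp_all add: cd)
  have S: "open ?S" "snd c p \<in> ?S"
    using open_chart_overlap A p by auto
  have eq: "(transition d e \<circ> transition c d) x = transition c e x" if "x \<in> ?S" for x
    using that by (auto simp: transition_def chart_inv_chart A)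
  have "(transition c e has_derivative ?D) (at (snd c p))"
    by (rule has_derivative_transform_within_open[OF D S eq])
  from frechet_derivative_at[OF this] show ?thesis by (metis comp_apply)
qed

lemma (in complex_manifold) transition_self:
  assumes c: "c \<in> charts_at A p"
  shows "frechet_derivative (transition c c) (at (snd c p)) \<eta> = \<eta>"
proof -
  have A: "c \<in> A" "p \<in> fst c" using c by (auto simp: charts_at_def)
  have "transition c c x = x" if "x \<in> chart_image c" for x
    using that by (auto simp: transition_def chart_inv_chart A chart_image_def)
  then have "(transition c c has_derivative (\<lambda>x. x)) (at (snd c p))"
    using chart_image_open[OF A(1)] A
    by (intro has_derivative_transform_within_open[OF has_derivative_ident])
      (auto simp: chart_image_def)
  from frechet_derivative_at[OF this] show ?thesis by metis
qed

lemma (in complex_manifold) bij_betw_tangent_point: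
  assumes c: "c \<in> A"
  shows "bij_betw (tangent_point A c) (chart_image c \<times> UNIV)
           {(p, v) \<in> hol_tangent_bundle X A. p \<in> fst c}"
proof (rule bij_betw_byWitness[where f' = "\<lambda>(p, v). (snd c p, v c)"])
  show "\<forall>x\<in>chart_image c \<times> UNIV. (\<lambda>(p, v). (snd c p, v c)) (tangent_point A c x) = x"
    using c transition_self[of c]
    by (auto simp: tangent_point_def chart_image_def chart_inv_chart charts_at_def)
  show "\<forall>x\<in>{(p, v) \<in> hol_tangent_bundle X A. p \<in> fst c}.
          tangent_point A c ((\<lambda>(p, v). (snd c p, v c)) x) = x"
  proof clarify
    fix p v assume v: "(p, v) \<in> hol_tangent_bundle X A" and p: "p \<in> fst c"
    have v1: "v d = frechet_derivative (transition c d) (at (snd c p)) (v c)" if "d \<in> charts_at A p" for d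
    proof -
      have "c \<in> charts_at A p" using c p by (simp add: charts_at_def)
      then show ?thesis
        using v that unfolding hol_tangent_bundle_def hol_tangent_space_def by blast
    qed
    have v0: "v d = 0" if "d \<notin> charts_at A p" for d
      using v that unfolding hol_tangent_bundle_def hol_tangent_space_def by blast
    have "(\<lambda>d. if d \<in> charts_at A p
        then frechet_derivative (transition c d) (at (snd c p)) (v c) else 0) = v"
      by (rule ext) (auto intro: v0 v1 [symmetric])
    then show "tangent_point A c (snd c p, v c) = (p, v)"
      by (simp add: tangent_point_def chart_inv_chart[OF c p])
  qed
  show "tangent_point A c ` (chart_image c \<times> UNIV) \<subseteq> {(p, v) \<in> hol_tangent_bundle X A. p \<in> fst c}"
  proof (rule image_subsetI)
    fix x assume "x \<in> chart_image c \<times> (UNIV :: (complex^'n) set)"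
    then obtain z \<eta> where x: "x = (z, \<eta>)" and z: "z \<in> chart_image c" by auto
    obtain q w where qw: "(q, w) = tangent_point A c (z, \<eta>)" by (metis surj_pair)
    from z obtain p where p: "p \<in> fst c" "z = snd c p" by (auto simp: chart_image_def)
    then have q: "q = p" and w: "w = (\<lambda>d. if d \<in> charts_at A p
        then frechet_derivative (transition c d) (at (snd c p)) \<eta> else 0)"
      using qw c by (auto simp: tangent_point_def chart_inv_chart)
    have "c \<in> charts_at A p" using c p by (simp add: charts_at_def)
    then have "w e = frechet_derivative (transition d e) (at (snd d p)) (w d)"
      if "d \<in> charts_at A p" "e \<in> charts_at A p" for d e
      using transition_cocycle[of c p d e \<eta>] that by (simp only: w if_True)
    moreover have "w d = 0" if "d \<notin> charts_at A p" for d
      using that by (simp only: w if_False)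
    ultimately have "w \<in> hol_tangent_space A p"
      unfolding hol_tangent_space_def by blast
    moreover have "p \<in> topspace X"
      using p openin_subset[OF chart_domain_open[OF c]] by blast
    ultimately show "tangent_point A c x \<in> {(p, v) \<in> hol_tangent_bundle X A. p \<in> fst c}"
      unfolding x qw[symmetric] using p q by (simp add: hol_tangent_bundle_def)
  qed
  show "(\<lambda>(p, v). (snd c p, v c)) ` {(p, v) \<in> hol_tangent_bundle X A. p \<in> fst c}
          \<subseteq> chart_image c \<times> UNIV"
    by (auto simp: chart_image_def)
qed


subsection \<open>Wirtinger derivatives\<close>

text \<open>
  Derivatives of a function of \<open>(z, \<eta>)\<close> with respect to \<open>z\<^sup>k\<close>, its conjugate, \<open>\<eta>\<^sup>k\<close> and its
  conjugate; \<open>axis k \<i>\<close> is the imaginary direction of the \<open>k\<close>-th coordinate.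
\<close>

definition dz :: "'n::finite \<Rightarrow> ('n coords \<Rightarrow> complex) \<Rightarrow> 'n coords \<Rightarrow> complex" where
  "dz k f x = (frechet_derivative f (at x) (axis k 1, 0)
               - \<i> * frechet_derivative f (at x) (axis k \<i>, 0)) / 2"

definition dzbar :: "'n::finite \<Rightarrow> ('n coords \<Rightarrow> complex) \<Rightarrow> 'n coords \<Rightarrow> complex" where
  "dzbar k f x = (frechet_derivative f (at x) (axis k 1, 0)
                  + \<i> * frechet_derivative f (at x) (axis k \<i>, 0)) / 2"

definition deta :: "'n::finite \<Rightarrow> ('n coords \<Rightarrow> complex) \<Rightarrow> 'n coords \<Rightarrow> complex" where
  "deta k f x = (frechet_derivative f (at x) (0, axis k 1)
                 - \<i> * frechet_derivative f (at x) (0, axis k \<i>)) / 2"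

definition detabar :: "'n::finite \<Rightarrow> ('n coords \<Rightarrow> complex) \<Rightarrow> 'n coords \<Rightarrow> complex" where
  "detabar k f x = (frechet_derivative f (at x) (0, axis k 1)
                    + \<i> * frechet_derivative f (at x) (0, axis k \<i>)) / 2"


subsection \<open>Chern--Finsler connection and curvature in local coordinates\<close>

context
  fixes L :: "'n::finite coords \<Rightarrow> real"
begin

text \<open>\<open>fund_tensor i j\<close> is \<open>g\<close> with lower indices \<open>i\<close>, \<open>j\<close>-bar.\<close>
definition fund_tensor :: "'n \<Rightarrow> 'n \<Rightarrow> 'n coords \<Rightarrow> complex" where
  "fund_tensor i j = deta i (detabar j (\<lambda>x. complex_of_real (L x)))"

text \<open>\<open>fund_inverse m i\<close> is \<open>g\<close> with upper indices \<open>m\<close>-bar, \<open>i\<close>.\<close>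
definition fund_inverse :: "'n \<Rightarrow> 'n \<Rightarrow> 'n coords \<Rightarrow> complex" where
  "fund_inverse m i x = matrix_inv (\<chi> a b. fund_tensor a b x) $ m $ i"

text \<open>\<open>nonlinear_conn k j\<close> is \<open>N\<close> with upper index \<open>k\<close>, lower index \<open>j\<close>.\<close>
definition nonlinear_conn :: "'n \<Rightarrow> 'n \<Rightarrow> 'n coords \<Rightarrow> complex" where
  "nonlinear_conn k j x =
     (\<Sum>m\<in>UNIV. \<Sum>l\<in>UNIV. fund_inverse m k x * dz j (fund_tensor l m) x * snd x $ l)"

definition hdel :: "'n \<Rightarrow> ('n coords \<Rightarrow> complex) \<Rightarrow> 'n coords \<Rightarrow> complex" where
  "hdel k f x = dz k f x - (\<Sum>j\<in>UNIV. nonlinear_conn j k x * deta j f x)"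

definition hdelbar :: "'n \<Rightarrow> ('n coords \<Rightarrow> complex) \<Rightarrow> 'n coords \<Rightarrow> complex" where
  "hdelbar k f x = dzbar k f x - (\<Sum>j\<in>UNIV. cnj (nonlinear_conn j k x) * detabar j f x)"

text \<open>In \<open>conn_L i j k\<close> and \<open>conn_C i j k\<close> the first index is the upper one.\<close>
definition conn_L :: "'n \<Rightarrow> 'n \<Rightarrow> 'n \<Rightarrow> 'n coords \<Rightarrow> complex" where
  "conn_L i j k x = (\<Sum>l\<in>UNIV. fund_inverse l i x * hdel k (fund_tensor j l) x)"

definition conn_C :: "'n \<Rightarrow> 'n \<Rightarrow> 'n \<Rightarrow> 'n coords \<Rightarrow> complex" where
  "conn_C i j k x = (\<Sum>l\<in>UNIV. fund_inverse l i x * deta k (fund_tensor j l) x)"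

text \<open>\<open>curvature i j h k\<close>: upper index \<open>i\<close>, lower indices \<open>j\<close>, \<open>h\<close>-bar, \<open>k\<close>.\<close>
definition curvature :: "'n \<Rightarrow> 'n \<Rightarrow> 'n \<Rightarrow> 'n \<Rightarrow> 'n coords \<Rightarrow> complex" where
  "curvature i j h k x =
     - hdelbar h (conn_L i j k) x - (\<Sum>l\<in>UNIV. hdelbar h (nonlinear_conn l k) x * conn_C i j l x)"

text \<open>\<open>curvature_low r j h k\<close>: lower indices \<open>r\<close>-bar, \<open>j\<close>, \<open>h\<close>-bar, \<open>k\<close>.\<close>
definition curvature_low :: "'n \<Rightarrow> 'n \<Rightarrow> 'n \<Rightarrow> 'n \<Rightarrow> 'n coords \<Rightarrow> complex" where
  "curvature_low r j h k x = (\<Sum>i\<in>UNIV. fund_tensor i r x * curvature i j h k x)"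

end


subsection \<open>Complex Finsler spaces\<close>

definition hermitian_pos_def :: "complex^'n^'n::finite \<Rightarrow> bool" where
  "hermitian_pos_def G \<longleftrightarrow> (\<forall>i j. G $ j $ i = cnj (G $ i $ j)) \<and>
     (\<forall>v. v \<noteq> 0 \<longrightarrow> 0 < Re (\<Sum>i\<in>UNIV. \<Sum>j\<in>UNIV. G $ i $ j * v $ i * cnj (v $ j)))"

text \<open>\<open>L = F\<^sup>2\<close> in the natural coordinates of the chart \<open>c\<close>.\<close>
definition local_L ::
    "('a, 'n::finite) chart set \<Rightarrow> ('a \<times> ('a, 'n) tvec \<Rightarrow> real) \<Rightarrow> ('a, 'n) chart \<Rightarrow> 'n coords \<Rightarrow> real" where
  "local_L A F c x = (F (tangent_point A c x))\<^sup>2"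

locale complex_finsler_space = complex_manifold X A
  for X :: "'a topology" and A :: "('a, 'n::finite) chart set" +
  fixes F :: "'a \<times> ('a, 'n) tvec \<Rightarrow> real"
  assumes F_nonneg: "u \<in> hol_tangent_bundle X A \<Longrightarrow> 0 \<le> F u"
    and F_continuous: "continuous_map (tangent_topology A) euclideanreal F"
    and L_smooth: "c \<in> A \<Longrightarrow> smooth_on (slit_coords c) (local_L A F c)"
    and F_eq_0_iff: "(p, v) \<in> hol_tangent_bundle X A \<Longrightarrow> F (p, v) = 0 \<longleftrightarrow> v = tvec_zero"
    and F_homogeneous:
      "(p, v) \<in> hol_tangent_bundle X A \<Longrightarrow> F (p, tvec_scale a v) = cmod a * F (p, v)"
    and fund_tensor_pos_def:
      "c \<in> A \<Longrightarrow> x \<in> slit_coords c \<Longrightarrow> hermitian_pos_def (\<chi> i j. fund_tensor (local_L A F c) i j x)"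

definition purely_hermitian ::
    "('a, 'n::finite) chart set \<Rightarrow> ('a \<times> ('a, 'n) tvec \<Rightarrow> real) \<Rightarrow> bool" where
  "purely_hermitian A F \<longleftrightarrow>
     (\<forall>c\<in>A. \<forall>i j z \<eta> \<eta>'. (z, \<eta>) \<in> slit_coords c \<longrightarrow> (z, \<eta>') \<in> slit_coords c \<longrightarrow>
        fund_tensor (local_L A F c) i j (z, \<eta>) = fund_tensor (local_L A F c) i j (z, \<eta>'))"

end

theory Submission
  imports Defs
begin

text \<open>
  Contracting the curvature with \<open>\<eta>\<close> turns the hypothesis into
  \<open>- \<delta>\<^bsub>h\<^esub>N\<^sup>i\<^sub>k = K (\<eta>\<^sup>i g\<^bsub>kh\<^esub> + \<delta>\<^sup>i\<^sub>k \<eta>\<^sub>h)\<close>, where \<open>h\<close> is a barred index.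
  Differentiate this with respect to \<open>\<eta>\<^sup>j\<close> and compare with the uncontracted hypothesis; the
  only term not controlled by \<open>K\<close> disappears on contraction with \<open>\<partial>L/\<partial>\<eta>\<^sup>i\<close>, and further
  contractions give \<open>\<partial>K/\<partial>\<eta>\<^sup>j = 0\<close> and \<open>K \<partial>g/\<partial>\<eta>\<^sup>j = 0\<close>. Thus \<open>K\<close> depends on \<open>z\<close> only, and the
  metric is Hermitian over the points where \<open>K \<noteq> 0\<close>.

  Applying instead a second barred \<open>\<delta>\<close>, and using that the barred \<open>\<delta>\<close>'s commute, gives a linear
  first order equation \<open>dK = K \<theta>\<close> when the dimension is at least 2. Hence the zero set of \<open>K\<close> is
  open as well as closed, so on a connected \<open>M\<close> either \<open>K\<close> vanishes identically or it vanishes nowhere.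
\<close>

section \<open>Smooth functions and mixed partial derivatives\<close>

text \<open>No regularity of K is assumed, so none of these equations may be differentiated at
  first. Tracing the contracted identity and pairing it with conjugate \<eta> solves it for K with
  denominator (n + 1) L, and L > 0 off the zero section; this makes K smooth.

  The uncontrolled term in the derivative along \<eta>^j is the commutator of that derivative with
  the barred \<delta>: it pairs the \<eta>-derivative of conjugate N with the conjugate
  \<eta>-derivative of N. Contracted with dL/d\<eta>^i it becomes a horizontal derivative of an
  Euler relation, hence zero.

  The equation on the base comes from two traces of one symmetric expression. The derivative of K
  occurs n times in one and once in the other, so the factor n - 1 remains, and \<theta> is a trace
  of the torsion. No Kaehler condition is imposed, so \<theta> may be nonzero and K need not be
  constant; the equation still forbids K to vanish at a point without vanishing nearby. This is what
  excludes a mixture of Hermitian fibres and non-Hermitian fibres with K = 0.\<close>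

abbreviation dir_deriv :: "'a::real_normed_vector \<Rightarrow> ('a \<Rightarrow> 'b::real_normed_vector) \<Rightarrow> 'a \<Rightarrow> 'b" where
  "dir_deriv v f x \<equiv> frechet_derivative f (at x) v"

lemma dir_deriv_eq: "(f has_derivative f') (at x) \<Longrightarrow> dir_deriv v f x = f' v"
  by (metis frechet_derivative_at)

lemma dir_deriv_cong:
  assumes "open S" "x \<in> S" "\<And>y. y \<in> S \<Longrightarrow> f y = g y"
  shows "dir_deriv v f x = dir_deriv v g x"
proof -
  have "(f has_derivative f') (at x) \<longleftrightarrow> (g has_derivative f') (at x)" for f'
    using has_derivative_transform_within_open[OF _ assms(1,2), of f f' UNIV g]
      has_derivative_transform_within_open[OF _ assms(1,2), of g f' UNIV f] assms(3) by auto
  then show ?thesis by (simp add: frechet_derivative_def)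
qed

lemma differentiable_cong_open:
  assumes "open S" "x \<in> S" "\<And>y. y \<in> S \<Longrightarrow> f y = g y"
  shows "f differentiable (at x) \<longleftrightarrow> g differentiable (at x)"
  using has_derivative_transform_within_open[OF _ assms(1,2), of f _ UNIV g]
      has_derivative_transform_within_open[OF _ assms(1,2), of g _ UNIV f] assms(3)
  unfolding differentiable_def by metis

section \<open>Locality and closure properties of C^k and smooth maps\<close>

lemma Ck_on_cong:
  assumes "open S" "\<And>y. y \<in> S \<Longrightarrow> f y = g y"
  shows "Ck_on k S f \<longleftrightarrow> Ck_on k S g"
  using assms(2)
proof (induction k arbitrary: f g)
  case 0
  then show ?case by (simp cong: continuous_on_cong)
next
  case (Suc k)
  have "Ck_on k S (dir_deriv v f) \<longleftrightarrow> Ck_on k S (dir_deriv v g)" for v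
    by (rule Suc.IH) (rule dir_deriv_cong[OF assms(1) _ Suc.prems])
  moreover have "f differentiable (at x) \<longleftrightarrow> g differentiable (at x)" if "x \<in> S" for x
    by (rule differentiable_cong_open[OF assms(1) that Suc.prems])
  ultimately show ?case by auto
qed

lemma Ck_on_imp_continuous_on:
  assumes "Ck_on k S f" shows "continuous_on S f"
proof (cases k)
  case (Suc m)
  then show ?thesis
    using assms by (auto intro!: continuous_at_imp_continuous_on differentiable_imp_continuous_within)
qed (use assms in auto)

lemma Ck_on_Suc_imp: "Ck_on (Suc k) S f \<Longrightarrow> Ck_on k S f"
proof (induction k arbitrary: f)
  case 0
  then show ?case using Ck_on_imp_continuous_on[OF 0] by simp
next
  case (Suc k)
  then show ?case by (metis Ck_on.simps(2))
qed

lemma Ck_on_const: "Ck_on k S (\<lambda>x. c)"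
  by (induction k arbitrary: c) auto

lemma Ck_on_add:
  assumes "open S"
  shows "Ck_on k S f \<Longrightarrow> Ck_on k S g \<Longrightarrow> Ck_on k S (\<lambda>x. f x + g x)"
proof (induction k arbitrary: f g)
  case (Suc k)
  have "Ck_on k S (dir_deriv v (\<lambda>x. f x + g x))" for v
  proof -
    have "dir_deriv v (\<lambda>x. f x + g x) x = dir_deriv v f x + dir_deriv v g x" if "x \<in> S" for x
      using Suc.prems that
      by (intro dir_deriv_eq[THEN trans, OF has_derivative_add])
        (auto simp: frechet_derivative_works)
    then show ?thesis
      using Suc.IH Suc.prems by (subst Ck_on_cong[OF assms]) auto
  qed
  then show ?case using Suc.prems by (auto intro: differentiable_add)
qed (auto intro: continuous_intros)

lemma Ck_on_bounded_linear:
  assumes "open S" "bounded_linear h"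
  shows "Ck_on k S f \<Longrightarrow> Ck_on k S (\<lambda>x. h (f x))"
proof (induction k arbitrary: f)
  case 0
  then show ?case using assms(2) bounded_linear.continuous_on by auto
next
  case (Suc k)
  have der: "((\<lambda>x. h (f x)) has_derivative (\<lambda>v. h (dir_deriv v f x))) (at x)" if "x \<in> S" for x
    using Suc.prems that bounded_linear.has_derivative[OF assms(2)]
    by (auto simp: frechet_derivative_works)
  have "Ck_on k S (dir_deriv v (\<lambda>x. h (f x)))" for v
    using Suc.IH[of "dir_deriv v f"] Suc.prems dir_deriv_eq[OF der]
    by (subst Ck_on_cong[OF assms(1)]) auto
  then show ?case using der by (auto simp: differentiable_def)
qed

lemma Ck_on_mult:
  fixes f g :: "'a::real_normed_vector \<Rightarrow> 'b::real_normed_algebra"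
  assumes "open S"
  shows "Ck_on k S f \<Longrightarrow> Ck_on k S g \<Longrightarrow> Ck_on k S (\<lambda>x. f x * g x)"
proof (induction k arbitrary: f g)
  case (Suc k)
  have "Ck_on k S (dir_deriv v (\<lambda>x. f x * g x))" for v
  proof -
    have "dir_deriv v (\<lambda>x. f x * g x) x = f x * dir_deriv v g x + dir_deriv v f x * g x" if "x \<in> S" for x
      using Suc.prems that
      by (intro dir_deriv_eq[THEN trans, OF has_derivative_mult])
        (auto simp: frechet_derivative_works)
    moreover have "Ck_on k S (\<lambda>x. f x * dir_deriv v g x + dir_deriv v f x * g x)"
      using Suc.IH Suc.prems Ck_on_Suc_imp[OF Suc.prems(1)] Ck_on_Suc_imp[OF Suc.prems(2)]
      by (intro Ck_on_add[OF assms]) auto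
    ultimately show ?thesis by (subst Ck_on_cong[OF assms])
  qed
  then show ?case using Suc.prems by (auto intro: differentiable_mult)
qed (auto intro: continuous_intros)

lemma Ck_on_inverse:
  fixes f :: "'a::real_normed_vector \<Rightarrow> 'b::real_normed_field"
  assumes "open S" "\<And>x. x \<in> S \<Longrightarrow> f x \<noteq> 0"
  shows "Ck_on k S f \<Longrightarrow> Ck_on k S (\<lambda>x. inverse (f x))"
proof (induction k)
  case 0
  then show ?case using assms by (auto intro!: continuous_intros)
next
  case (Suc k)
  have der: "((\<lambda>x. inverse (f x)) has_derivative
       (\<lambda>v. - (inverse (f x) * dir_deriv v f x * inverse (f x)))) (at x)" if "x \<in> S" for x
    using Suc.prems that by (intro Deriv.has_derivative_inverse assms) (auto simp: frechet_derivative_works)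
  have IH: "Ck_on k S (\<lambda>x. inverse (f x))"
    by (rule Suc.IH[OF Ck_on_Suc_imp[OF Suc.prems]])
  \<comment> \<open>The sign is written as a constant factor so that \<open>Ck_on_mult\<close> and
    \<open>Ck_on_const\<close> cover it.\<close>
  have "Ck_on k S (\<lambda>x. (-1) * (inverse (f x) * dir_deriv v f x * inverse (f x)))" for v
    using IH Suc.prems by (intro Ck_on_mult[OF assms(1)] Ck_on_const) auto
  then have "Ck_on k S (dir_deriv v (\<lambda>x. inverse (f x)))" for v
    using dir_deriv_eq[OF der] by (subst Ck_on_cong[OF assms(1)]) auto
  then show ?case using der by (auto simp: differentiable_def)
qed

lemma smooth_on_cong:
  "open S \<Longrightarrow> (\<And>y. y \<in> S \<Longrightarrow> f y = g y) \<Longrightarrow> smooth_on S f \<longleftrightarrow> smooth_on S g"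
  unfolding smooth_on_def by (metis Ck_on_cong)

lemma smooth_on_differentiable: "smooth_on S f \<Longrightarrow> x \<in> S \<Longrightarrow> f differentiable (at x)"
  unfolding smooth_on_def by (metis Ck_on.simps(2))

lemma smooth_on_has_derivative:
  "smooth_on S f \<Longrightarrow> x \<in> S \<Longrightarrow> (f has_derivative frechet_derivative f (at x)) (at x)"
  using smooth_on_differentiable frechet_derivative_works by blast

lemma smooth_on_dir_deriv: "smooth_on S f \<Longrightarrow> smooth_on S (dir_deriv v f)"
  unfolding smooth_on_def by (metis Ck_on.simps(2))

lemma smooth_on_imp_continuous_on: "smooth_on S f \<Longrightarrow> continuous_on S f"
  unfolding smooth_on_def by (metis Ck_on.simps(1))

lemma smooth_on_const: "smooth_on S (\<lambda>x. c)"
  by (simp add: smooth_on_def Ck_on_const)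

lemma smooth_on_bounded_linear:
  "open S \<Longrightarrow> bounded_linear h \<Longrightarrow> smooth_on S f \<Longrightarrow> smooth_on S (\<lambda>x. h (f x))"
  by (simp add: smooth_on_def Ck_on_bounded_linear)

lemma smooth_on_add:
  "open S \<Longrightarrow> smooth_on S f \<Longrightarrow> smooth_on S g \<Longrightarrow> smooth_on S (\<lambda>x. f x + g x)"
  by (simp add: smooth_on_def Ck_on_add)

lemma smooth_on_mult:
  fixes f g :: "'a::real_normed_vector \<Rightarrow> 'b::real_normed_algebra"
  shows "open S \<Longrightarrow> smooth_on S f \<Longrightarrow> smooth_on S g \<Longrightarrow> smooth_on S (\<lambda>x. f x * g x)"
  by (simp add: smooth_on_def Ck_on_mult)

lemma smooth_on_inverse:
  fixes f :: "'a::real_normed_vector \<Rightarrow> 'b::real_normed_field"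
  shows "open S \<Longrightarrow> (\<And>x. x \<in> S \<Longrightarrow> f x \<noteq> 0) \<Longrightarrow> smooth_on S f \<Longrightarrow> smooth_on S (\<lambda>x. inverse (f x))"
  by (simp add: smooth_on_def Ck_on_inverse)

lemma smooth_on_minus: "open S \<Longrightarrow> smooth_on S f \<Longrightarrow> smooth_on S (\<lambda>x. - f x)"
  by (rule smooth_on_bounded_linear[OF _ bounded_linear_minus[OF bounded_linear_ident]])

lemma smooth_on_diff:
  "open S \<Longrightarrow> smooth_on S f \<Longrightarrow> smooth_on S g \<Longrightarrow> smooth_on S (\<lambda>x. f x - g x)"
  using smooth_on_add[OF _ _ smooth_on_minus, of S f g] by simp

lemma smooth_on_divide:
  fixes f g :: "'a::real_normed_vector \<Rightarrow> 'b::real_normed_field"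
  shows "open S \<Longrightarrow> (\<And>x. x \<in> S \<Longrightarrow> g x \<noteq> 0) \<Longrightarrow> smooth_on S f \<Longrightarrow> smooth_on S g \<Longrightarrow>
    smooth_on S (\<lambda>x. f x / g x)"
  unfolding divide_inverse by (intro smooth_on_mult smooth_on_inverse)

lemma smooth_on_sum:
  "open S \<Longrightarrow> (\<And>i. i \<in> I \<Longrightarrow> smooth_on S (f i)) \<Longrightarrow> smooth_on S (\<lambda>x. \<Sum>i\<in>I. f i x)"
  by (induction I rule: infinite_finite_induct) (auto intro: smooth_on_const smooth_on_add)

lemma smooth_on_prod:
  fixes f :: "'i \<Rightarrow> 'a::real_normed_vector \<Rightarrow> 'b::real_normed_field"
  shows "open S \<Longrightarrow> (\<And>i. i \<in> I \<Longrightarrow> smooth_on S (f i)) \<Longrightarrow> smooth_on S (\<lambda>x. \<Prod>i\<in>I. f i x)"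
  by (induction I rule: infinite_finite_induct) (auto intro: smooth_on_const smooth_on_mult)

lemma smooth_on_of_real:
  "open S \<Longrightarrow> smooth_on S f \<Longrightarrow> smooth_on S (\<lambda>x. complex_of_real (f x))"
  by (rule smooth_on_bounded_linear[OF _ bounded_linear_of_real])

lemma smooth_on_cnj: "open S \<Longrightarrow> smooth_on S f \<Longrightarrow> smooth_on S (\<lambda>x. cnj (f x))"
  by (rule smooth_on_bounded_linear[OF _ bounded_linear_cnj])

lemma smooth_on_linear:
  assumes "bounded_linear h" "open S" shows "smooth_on S h"
proof -
  have "dir_deriv v h = (\<lambda>x. h v)" for v
    using dir_deriv_eq[OF bounded_linear_imp_has_derivative[OF assms(1)]] by auto
  moreover have "h differentiable (at x)" for x
    using bounded_linear_imp_has_derivative[OF assms(1)] by (auto simp: differentiable_def)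
  ultimately have "Ck_on (Suc k) S h" for k
    by (simp add: Ck_on_const)
  then show ?thesis unfolding smooth_on_def using Ck_on_Suc_imp by blast
qed

section \<open>Symmetry of second derivatives, through second differences\<close>

lemma second_difference:
  fixes f :: "'a::real_normed_vector \<Rightarrow> real"
  assumes f: "smooth_on (ball x r) f" and h: "0 < h" "h * (norm v + norm w) < r"
  obtains y where "dist x y \<le> h * (norm v + norm w)"
    "f (x + h *\<^sub>R v + h *\<^sub>R w) - f (x + h *\<^sub>R v) - f (x + h *\<^sub>R w) + f x =
       h\<^sup>2 * dir_deriv w (dir_deriv v f) y"
proof -
  have le: "dist x (x + s *\<^sub>R v + t *\<^sub>R w) \<le> h * (norm v + norm w)"
    if "0 \<le> s" "s \<le> h" "0 \<le> t" "t \<le> h" for s t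
  proof -
    have "norm (s *\<^sub>R v + t *\<^sub>R w) \<le> s * norm v + t * norm w"
      using norm_triangle_ineq[of "s *\<^sub>R v" "t *\<^sub>R w"] that by simp
    also have "\<dots> \<le> h * (norm v + norm w)"
      using that by (simp add: distrib_left add_mono mult_right_mono)
    also have "dist x (x + s *\<^sub>R v + t *\<^sub>R w) = norm (s *\<^sub>R v + t *\<^sub>R w)"
      using norm_minus_cancel[of "s *\<^sub>R v + t *\<^sub>R w"] by (simp add: dist_norm algebra_simps)
    ultimately show ?thesis by simp
  qed
  have inb: "x + s *\<^sub>R v + t *\<^sub>R w \<in> ball x r" if "0 \<le> s" "s \<le> h" "0 \<le> t" "t \<le> h" for s t
    using le[OF that] h by simp
  have der1: "((\<lambda>s. f (x + s *\<^sub>R v + t *\<^sub>R w)) has_real_derivative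
      dir_deriv v f (x + s *\<^sub>R v + t *\<^sub>R w)) (at s)" if "0 \<le> s" "s \<le> h" "0 \<le> t" "t \<le> h" for s t
  proof -
    have "((\<lambda>s. x + s *\<^sub>R v + t *\<^sub>R w) has_derivative (\<lambda>ds. ds *\<^sub>R v)) (at s)"
      by (auto intro!: derivative_eq_intros)
    from has_derivative_compose[OF this smooth_on_has_derivative[OF f inb[OF that]]]
    show ?thesis
      using linear_frechet_derivative[OF smooth_on_differentiable[OF f inb[OF that]]]
      by (simp add: has_field_derivative_def linear_scale) (simp add: mult_commute_abs)
  qed
  have der2: "((\<lambda>t. dir_deriv v f (x + s *\<^sub>R v + t *\<^sub>R w)) has_real_derivative
      dir_deriv w (dir_deriv v f) (x + s *\<^sub>R v + t *\<^sub>R w)) (at t)" if "0 \<le> s" "s \<le> h" "0 \<le> t" "t \<le> h" for s t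
  proof -
    have f': "smooth_on (ball x r) (dir_deriv v f)" by (rule smooth_on_dir_deriv[OF f])
    have "((\<lambda>t. x + s *\<^sub>R v + t *\<^sub>R w) has_derivative (\<lambda>dt. dt *\<^sub>R w)) (at t)"
      by (auto intro!: derivative_eq_intros)
    from has_derivative_compose[OF this smooth_on_has_derivative[OF f' inb[OF that]]]
    show ?thesis
      using linear_frechet_derivative[OF smooth_on_differentiable[OF f' inb[OF that]]]
      by (simp add: has_field_derivative_def linear_scale) (simp add: mult_commute_abs)
  qed
  \<comment> \<open>The second difference is the increment of \<open>g\<close> over [0, h]. The mean
    value theorem is applied to \<open>g\<close> in the direction v, and then to the resulting
    difference in the direction w. The term with factor 0 is kept so that \<open>der1\<close>
    applies to both summands.\<close>
  define g where "g s = f (x + s *\<^sub>R v + h *\<^sub>R w) - f (x + s *\<^sub>R v + 0 *\<^sub>R w)" for s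
  have "\<exists>s>0. s < h \<and> g h - g 0 = (h - 0) * (dir_deriv v f (x + s *\<^sub>R v + h *\<^sub>R w) - dir_deriv v f (x + s *\<^sub>R v + 0 *\<^sub>R w))"
    unfolding g_def
    by (rule MVT2[OF h(1)]) (intro DERIV_diff der1; use h in simp)
  then obtain s where s: "0 < s" "s < h" and
    gs: "g h - g 0 = h * (dir_deriv v f (x + s *\<^sub>R v + h *\<^sub>R w) - dir_deriv v f (x + s *\<^sub>R v + 0 *\<^sub>R w))"
    by auto
  have "\<exists>t>0. t < h \<and> dir_deriv v f (x + s *\<^sub>R v + h *\<^sub>R w) - dir_deriv v f (x + s *\<^sub>R v + 0 *\<^sub>R w) =
     (h - 0) * dir_deriv w (dir_deriv v f) (x + s *\<^sub>R v + t *\<^sub>R w)"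
    by (rule MVT2[OF h(1)]) (intro der2; use s in simp)
  then obtain t where t: "0 < t" "t < h" and
    "dir_deriv v f (x + s *\<^sub>R v + h *\<^sub>R w) - dir_deriv v f (x + s *\<^sub>R v + 0 *\<^sub>R w) =
     h * dir_deriv w (dir_deriv v f) (x + s *\<^sub>R v + t *\<^sub>R w)"
    by auto
  with gs have "g h - g 0 = h\<^sup>2 * dir_deriv w (dir_deriv v f) (x + s *\<^sub>R v + t *\<^sub>R w)"
    by (simp add: power2_eq_square)
  then show thesis
    using s t by (intro that[OF le[of s t]]) (auto simp: g_def algebra_simps)
qed

lemma Ck_on_subset: "Ck_on k S f \<Longrightarrow> T \<subseteq> S \<Longrightarrow> Ck_on k T f"
  by (induction k arbitrary: f) (auto intro: continuous_on_subset)

lemma smooth_on_subset: "smooth_on S f \<Longrightarrow> T \<subseteq> S \<Longrightarrow> smooth_on T f"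
  by (auto simp: smooth_on_def intro: Ck_on_subset)

text \<open>The second difference is symmetric in v and w. Hence at every scale some value of one
  mixed derivative near x equals some value of the other near x, and continuity at x gives equality
  there.\<close>

lemma dir_deriv_commute_real:
  fixes f :: "'a::real_normed_vector \<Rightarrow> real"
  assumes "open S" "smooth_on S f" "x \<in> S"
  shows "dir_deriv v (dir_deriv w f) x = dir_deriv w (dir_deriv v f) x"
proof -
  obtain r where r: "r > 0" "ball x r \<subseteq> S"
    using assms openE by blast
  have fb: "smooth_on (ball x r) f" by (rule smooth_on_subset[OF assms(2) r(2)])
  \<comment> \<open>The summand 1 keeps \<open>C\<close> positive when v and w both vanish.\<close>
  obtain C where C: "C = norm v + norm w + 1" by simp
  then have pos: "C > 0" by (smt (verit) norm_ge_zero)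
  \<comment> \<open>The factor 2 makes the bound by r strict already for n = 0.\<close>
  define H where "H n = r / (2 * C * real (Suc n))" for n
  have H0: "0 < H n" for n using r pos by (simp add: H_def)
  have Hr: "H n * (norm v + norm w) < r" for n
  proof -
    have "H n * (norm v + norm w) \<le> H n * C" using H0[of n] by (simp add: C)
    also have "\<dots> = r / (2 * real (Suc n))" using pos 
      unfolding H_def by (simp add: field_simps del: of_nat_Suc)
    also have "\<dots> < r" using r by (simp add: divide_simps)
    finally show ?thesis .
  qed
  have "(\<lambda>n. r / (2 * C) * inverse (real (Suc n))) \<longlonglongrightarrow> r / (2 * C) * 0"
    by (intro tendsto_mult tendsto_const LIMSEQ_inverse_real_of_nat)
  moreover have "H = (\<lambda>n. r / (2 * C) * inverse (real (Suc n)))"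
    by (rule ext) (simp add: H_def divide_simps del: of_nat_Suc)
  ultimately have "(\<lambda>n. H n * (norm v + norm w)) \<longlonglongrightarrow> 0"
    by (intro tendsto_mult_left_zero) simp
  then have lim: "y \<longlonglongrightarrow> x" if "\<And>n. dist x (y n) \<le> H n * (norm v + norm w)" for y
    using that by (intro metric_tendsto_imp_tendsto[of _ 0 _ y x]) (auto simp: dist_commute intro!: always_eventually order_trans[OF _ abs_ge_self])
  have "\<exists>y z. dist x y \<le> H n * (norm v + norm w) \<and> dist x z \<le> H n * (norm v + norm w) \<and>
     dir_deriv w (dir_deriv v f) y = dir_deriv v (dir_deriv w f) z" for n
  proof -
    obtain y where y: "dist x y \<le> H n * (norm v + norm w)"
      "f (x + H n *\<^sub>R v + H n *\<^sub>R w) - f (x + H n *\<^sub>R v) - f (x + H n *\<^sub>R w) + f x =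
       (H n)\<^sup>2 * dir_deriv w (dir_deriv v f) y"
      using second_difference[OF fb H0 Hr] by blast
    have "H n * (norm w + norm v) < r" using Hr[of n] by (simp add: add.commute)
    then obtain z where z: "dist x z \<le> H n * (norm w + norm v)"
      "f (x + H n *\<^sub>R w + H n *\<^sub>R v) - f (x + H n *\<^sub>R w) - f (x + H n *\<^sub>R v) + f x =
       (H n)\<^sup>2 * dir_deriv v (dir_deriv w f) z"
      using second_difference[OF fb H0] by blast
    have "(H n)\<^sup>2 * dir_deriv v (dir_deriv w f) z = (H n)\<^sup>2 * dir_deriv w (dir_deriv v f) y"
      unfolding y(2)[symmetric] z(2)[symmetric] by (simp add: add_ac)
    then show ?thesis using H0[of n] y z by (intro exI[of _ y] exI[of _ z]) (auto simp: add.commute)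
  qed
  then obtain y z where yz: "\<And>n. dist x (y n) \<le> H n * (norm v + norm w)"
    "\<And>n. dist x (z n) \<le> H n * (norm v + norm w)"
    and eq: "\<And>n. dir_deriv w (dir_deriv v f) (y n) = dir_deriv v (dir_deriv w f) (z n)"
    by metis
  have c: "isCont (dir_deriv a (dir_deriv b f)) x" for a b
    using smooth_on_imp_continuous_on[OF smooth_on_dir_deriv[OF smooth_on_dir_deriv[OF assms(2)]]]
      assms(1,3) by (simp add: continuous_on_eq_continuous_at)
  have "(\<lambda>n. dir_deriv w (dir_deriv v f) (y n)) \<longlonglongrightarrow> dir_deriv w (dir_deriv v f) x"
     "(\<lambda>n. dir_deriv v (dir_deriv w f) (z n)) \<longlonglongrightarrow> dir_deriv v (dir_deriv w f) x"
    by (rule isCont_tendsto_compose[OF c lim[OF yz(1)]] isCont_tendsto_compose[OF c lim[OF yz(2)]])+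
  then show ?thesis unfolding eq using LIMSEQ_unique by blast
qed

lemma dir_deriv_bounded_linear:
  assumes "bounded_linear h" "f differentiable (at x)"
  shows "dir_deriv v (\<lambda>x. h (f x)) x = h (dir_deriv v f x)"
  using dir_deriv_eq[OF bounded_linear.has_derivative[OF assms(1), of f]] assms(2)
  by (auto simp: frechet_derivative_works)

text \<open>The mean value theorem is a statement about real values, so the vector-valued case is
  reduced to components.\<close>

lemma dir_deriv_commute:
  fixes f :: "'a::real_normed_vector \<Rightarrow> 'b::euclidean_space"
  assumes "open S" "smooth_on S f" "x \<in> S"
  shows "dir_deriv v (dir_deriv w f) x = dir_deriv w (dir_deriv v f) x"
proof (rule euclidean_eqI)
  fix b :: 'b
  note bl = bounded_linear_inner_left[of b]
  have *: "dir_deriv v (dir_deriv w (\<lambda>x. f x \<bullet> b)) x = dir_deriv v (dir_deriv w f) x \<bullet> b" for v w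
  proof -
    have "dir_deriv v (dir_deriv w (\<lambda>x. f x \<bullet> b)) x = dir_deriv v (\<lambda>x. dir_deriv w f x \<bullet> b) x"
      using smooth_on_differentiable[OF assms(2)]
      by (intro dir_deriv_cong[OF assms(1,3)] dir_deriv_bounded_linear[OF bl])
    also have "\<dots> = dir_deriv v (dir_deriv w f) x \<bullet> b"
      using smooth_on_differentiable[OF smooth_on_dir_deriv[OF assms(2)] assms(3)]
      by (rule dir_deriv_bounded_linear[OF bl])
    finally show ?thesis .
  qed
  show "dir_deriv v (dir_deriv w f) x \<bullet> b = dir_deriv w (dir_deriv v f) x \<bullet> b"
    using dir_deriv_commute_real[OF assms(1) smooth_on_bounded_linear[OF assms(1) bl assms(2)] assms(3), of v w]
    by (simp add: *)
qed


section \<open>Derivations and Wirtinger derivatives\<close>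

text \<open>One interface for the coordinate derivatives and for the horizontal operators
  \<open>hdel\<close> and \<open>hdelbar\<close>, whose coefficients vary. The locality axiom
  \<open>cong\<close> is what allows an identity valid only on \<open>S\<close> to be
  differentiated.\<close>

locale derivation =
  fixes S :: "'a::real_normed_vector set" and T :: "('a \<Rightarrow> complex) \<Rightarrow> 'a \<Rightarrow> complex"
  assumes smooth: "smooth_on S f \<Longrightarrow> smooth_on S (T f)"
    and cong: "x \<in> S \<Longrightarrow> (\<And>y. y \<in> S \<Longrightarrow> f y = f' y) \<Longrightarrow> T f x = T f' x"
    and const: "x \<in> S \<Longrightarrow> T (\<lambda>x. c) x = 0"
    and add: "smooth_on S f \<Longrightarrow> smooth_on S f' \<Longrightarrow> x \<in> S \<Longrightarrow> T (\<lambda>x. f x + f' x) x = T f x + T f' x"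
    and mult: "smooth_on S f \<Longrightarrow> smooth_on S f' \<Longrightarrow> x \<in> S \<Longrightarrow>
      T (\<lambda>x. f x * f' x) x = T f x * f' x + f x * T f' x"
begin

lemma const_on: "x \<in> S \<Longrightarrow> (\<And>y. y \<in> S \<Longrightarrow> f y = c) \<Longrightarrow> T f x = 0"
  using cong[of x f "\<lambda>x. c"] const[of x c] by simp

lemma cmult: "smooth_on S f \<Longrightarrow> x \<in> S \<Longrightarrow> T (\<lambda>x. c * f x) x = c * T f x"
  using mult[OF smooth_on_const, of f x c] const by simp

lemma minus: "smooth_on S f \<Longrightarrow> x \<in> S \<Longrightarrow> T (\<lambda>x. - f x) x = - T f x"
  using cmult[of f x "-1"] by simp

lemma diff:
  "open S \<Longrightarrow> smooth_on S f \<Longrightarrow> smooth_on S f' \<Longrightarrow> x \<in> S \<Longrightarrow> T (\<lambda>x. f x - f' x) x = T f x - T f' x"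
  using add[of f "\<lambda>x. - f' x" x] smooth_on_minus[of S f'] minus[of f' x] by simp

lemma sum:
  "open S \<Longrightarrow> (\<And>i. i \<in> I \<Longrightarrow> smooth_on S (f i)) \<Longrightarrow> x \<in> S \<Longrightarrow>
    T (\<lambda>x. \<Sum>i\<in>I. f i x) x = (\<Sum>i\<in>I. T (f i) x)"
  by (induction I rule: infinite_finite_induct) (auto simp: const add smooth_on_sum)

lemma sum_mult:
  assumes "open S" "\<And>i. i \<in> I \<Longrightarrow> smooth_on S (f i)" "\<And>i. i \<in> I \<Longrightarrow> smooth_on S (f' i)" "x \<in> S"
  shows "T (\<lambda>x. \<Sum>i\<in>I. f i x * f' i x) x = (\<Sum>i\<in>I. T (f i) x * f' i x) + (\<Sum>i\<in>I. f i x * T (f' i) x)"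
  using assms by (subst sum) (auto simp: mult smooth_on_mult sum.distrib)

end

text \<open>Derivations form a module over the smooth functions. This is how the horizontal
  operators, with the coefficients N, inherit the product rule.\<close>

lemma derivation_lincomb:
  assumes "open S" "derivation S T" "derivation S T'" "smooth_on S a" "smooth_on S b"
  shows "derivation S (\<lambda>f x. a x * T f x + b x * T' f x)"
proof -
  interpret T: derivation S T by fact
  interpret T': derivation S T' by fact
  show ?thesis
  proof
    show "a x * T f x + b x * T' f x = a x * T f' x + b x * T' f' x"
      if "x \<in> S" "\<And>y. y \<in> S \<Longrightarrow> f y = f' y" for x f f'
      using T.cong[OF that] T'.cong[OF that] by simp
  qed (auto simp: algebra_simps T.const T.add T.mult T'.const T'.add T'.mult
      intro!: smooth_on_add smooth_on_mult assms T.smooth T'.smooth)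
qed

lemma derivation_zero: "open S \<Longrightarrow> derivation S (\<lambda>f x. 0)"
  by standard (auto intro: smooth_on_const)

lemma derivation_sum:
  assumes "open S" "\<And>i. i \<in> I \<Longrightarrow> derivation S (T i)" "\<And>i. i \<in> I \<Longrightarrow> smooth_on S (a i)"
  shows "derivation S (\<lambda>f x. \<Sum>i\<in>I. a i x * T i f x)"
  using assms(2,3)
proof (induction I rule: infinite_finite_induct)
  case (insert i I)
  then have "derivation S (\<lambda>f x. a i x * T i f x + 1 * (\<Sum>i\<in>I. a i x * T i f x))"
    by (intro derivation_lincomb assms(1) smooth_on_const) auto
  then show ?case using insert by simp
qed (auto intro: derivation_zero assms(1))

lemma derivation_dir_deriv: "open S \<Longrightarrow> derivation S (dir_deriv v)"
proof
  show "dir_deriv v (\<lambda>x. f x + f' x) x = dir_deriv v f x + dir_deriv v f' x"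
    if "smooth_on S f" "smooth_on S f'" "x \<in> S" for f f' :: "'a \<Rightarrow> complex" and x
    using dir_deriv_eq[OF has_derivative_add[OF smooth_on_has_derivative[OF that(1,3)] smooth_on_has_derivative[OF that(2,3)]]]
    by simp
  show "dir_deriv v (\<lambda>x. f x * f' x) x = dir_deriv v f x * f' x + f x * dir_deriv v f' x"
    if "smooth_on S f" "smooth_on S f'" "x \<in> S" for f f' :: "'a \<Rightarrow> complex" and x
    using dir_deriv_eq[OF has_derivative_mult[OF smooth_on_has_derivative[OF that(1,3)] smooth_on_has_derivative[OF that(2,3)]]]
    by simp
qed (auto intro: smooth_on_dir_deriv dir_deriv_cong)

text \<open>With w the rotation of v by the imaginary unit, c = -\<i> gives the holomorphic
  derivative and c = \<i> the antiholomorphic one. Leaving v, w and c free treats all four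
  coordinate families at once.\<close>

definition wirtinger :: "'a::real_normed_vector \<Rightarrow> 'a \<Rightarrow> complex \<Rightarrow> ('a \<Rightarrow> complex) \<Rightarrow> 'a \<Rightarrow> complex" where
  "wirtinger v w c f x = (dir_deriv v f x + c * dir_deriv w f x) / 2"

lemma dz_wirtinger: "dz k = wirtinger (axis k 1, 0) (axis k \<i>, 0) (- \<i>)"
  and dzbar_wirtinger: "dzbar k = wirtinger (axis k 1, 0) (axis k \<i>, 0) \<i>"
  and deta_wirtinger: "deta k = wirtinger (0, axis k 1) (0, axis k \<i>) (- \<i>)"
  and detabar_wirtinger: "detabar k = wirtinger (0, axis k 1) (0, axis k \<i>) \<i>"
  by (intro ext; simp add: dz_def dzbar_def deta_def detabar_def wirtinger_def)+

lemma derivation_wirtinger: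
  assumes "open S" shows "derivation S (wirtinger v w c)"
proof -
  have "derivation S (\<lambda>f x. (1/2) * dir_deriv v f x + (c/2) * dir_deriv w f x)"
    by (intro derivation_lincomb derivation_dir_deriv assms smooth_on_const)
  moreover have "(\<lambda>f x. (1/2) * dir_deriv v f x + (c/2) * dir_deriv w f x) = wirtinger v w c"
    by (intro ext) (simp add: wirtinger_def field_simps)
  ultimately show ?thesis by simp
qed

lemma wirtinger_commute:
  assumes "open S" "smooth_on S f" "x \<in> S"
  shows "wirtinger v w c (wirtinger v' w' c' f) x = wirtinger v' w' c' (wirtinger v w c f) x"
proof -
  have *: "dir_deriv u (wirtinger v w c f) x = (dir_deriv u (dir_deriv v f) x + c * dir_deriv u (dir_deriv w f) x) / 2" for u v w c
  proof -
    interpret D: derivation S "dir_deriv u" by (rule derivation_dir_deriv[OF assms(1)])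
    note sm = smooth_on_dir_deriv[OF assms(2)]
    have "dir_deriv u (wirtinger v w c f) x = dir_deriv u (\<lambda>x. (1/2) * (dir_deriv v f x + c * dir_deriv w f x)) x"
      by (intro D.cong[OF assms(3)]) (simp add: wirtinger_def)
    also have "\<dots> = (1/2) * dir_deriv u (\<lambda>x. dir_deriv v f x + c * dir_deriv w f x) x"
      using assms sm by (intro D.cmult smooth_on_add smooth_on_mult smooth_on_const)
    also have "dir_deriv u (\<lambda>x. dir_deriv v f x + c * dir_deriv w f x) x =
        dir_deriv u (dir_deriv v f) x + c * dir_deriv u (dir_deriv w f) x"
      using assms sm by (subst D.add) (auto simp: D.cmult intro!: smooth_on_mult smooth_on_const)
    finally show ?thesis by simp
  qed
  have "dir_deriv a (dir_deriv b f) x = dir_deriv b (dir_deriv a f) x" for a b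
    by (rule dir_deriv_commute[OF assms])
  then show ?thesis unfolding wirtinger_def[of _ _ _ "wirtinger _ _ _ _"] *
    by (simp add: field_simps)
qed

lemma wirtinger_cnj:
  assumes "f differentiable (at x)"
  shows "wirtinger v w c (\<lambda>x. cnj (f x)) x = cnj (wirtinger v w (cnj c) f x)"
  using dir_deriv_bounded_linear[OF bounded_linear_cnj assms] by (simp add: wirtinger_def)

lemma dz_cnj: "f differentiable (at x) \<Longrightarrow> dz k (\<lambda>x. cnj (f x)) x = cnj (dzbar k f x)"
  and dzbar_cnj: "f differentiable (at x) \<Longrightarrow> dzbar k (\<lambda>x. cnj (f x)) x = cnj (dz k f x)"
  and deta_cnj: "f differentiable (at x) \<Longrightarrow> deta k (\<lambda>x. cnj (f x)) x = cnj (detabar k f x)"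
  and detabar_cnj: "f differentiable (at x) \<Longrightarrow> detabar k (\<lambda>x. cnj (f x)) x = cnj (deta k f x)"
  by (simp_all add: dz_wirtinger dzbar_wirtinger deta_wirtinger detabar_wirtinger wirtinger_cnj)

section \<open>Derivatives of the fibre coordinates, and the real differential in terms of Wirtinger
  derivatives\<close>

lemma bounded_linear_fibre_coord: "bounded_linear (\<lambda>x :: 'n::finite coords. snd x $ k)"
  by (rule bounded_linear_compose[OF bounded_linear_vec_nth bounded_linear_snd])

lemma fibre_coord_differentiable: "(\<lambda>x :: 'n::finite coords. snd x $ k) differentiable (at x)"
  using bounded_linear_imp_has_derivative[OF bounded_linear_fibre_coord] by (auto simp: differentiable_def)

lemma dir_deriv_fibre_coord: "dir_deriv v (\<lambda>x :: 'n::finite coords. snd x $ k) x = snd v $ k"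
  by (rule dir_deriv_eq[OF bounded_linear_imp_has_derivative[OF bounded_linear_fibre_coord]])

lemma fibre_coord_derivs:
  fixes x :: "'n::finite coords"
  shows "dz j (\<lambda>x. snd x $ k) x = 0" "dzbar j (\<lambda>x. snd x $ k) x = 0"
    "deta j (\<lambda>x. snd x $ k) x = (if j = k then 1 else 0)" "detabar j (\<lambda>x. snd x $ k) x = 0"
  by (simp_all add: dz_def dzbar_def deta_def detabar_def dir_deriv_fibre_coord axis_def)

lemma fibre_coord_cnj_derivs:
  fixes x :: "'n::finite coords"
  shows "dz j (\<lambda>x. cnj (snd x $ k)) x = 0" "dzbar j (\<lambda>x. cnj (snd x $ k)) x = 0"
    "deta j (\<lambda>x. cnj (snd x $ k)) x = 0" "detabar j (\<lambda>x. cnj (snd x $ k)) x = (if j = k then 1 else 0)"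
  by (simp_all add: dz_cnj dzbar_cnj deta_cnj detabar_cnj fibre_coord_differentiable fibre_coord_derivs)

text \<open>A Frechet derivative is only real-linear, so a complex vector has to be expanded over
  the real basis; the two lemmas that follow regroup this expansion into holomorphic and
  antiholomorphic parts.\<close>

lemma vec_real_decomp:
  fixes \<eta> :: "complex^'n::finite"
  shows "(0, \<eta>) = (\<Sum>k\<in>UNIV. Re (\<eta> $ k) *\<^sub>R (0, axis k 1) + Im (\<eta> $ k) *\<^sub>R (0, axis k \<i>))"
    and "(\<eta>, 0) = (\<Sum>k\<in>UNIV. Re (\<eta> $ k) *\<^sub>R (axis k 1, 0) + Im (\<eta> $ k) *\<^sub>R (axis k \<i>, 0))"
proof -
  have *: "\<eta> = (\<Sum>k\<in>UNIV. Re (\<eta> $ k) *\<^sub>R axis k 1 + Im (\<eta> $ k) *\<^sub>R axis k \<i>)"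
    by (simp add: vec_eq_iff axis_def sum.distrib if_distrib complex_eq_iff cong: if_cong)
  show "(0, \<eta>) = (\<Sum>k\<in>UNIV. Re (\<eta> $ k) *\<^sub>R (0, axis k 1) + Im (\<eta> $ k) *\<^sub>R (0, axis k \<i>))"
    by (subst *) (simp add: prod_eq_iff fst_sum snd_sum)
  show "(\<eta>, 0) = (\<Sum>k\<in>UNIV. Re (\<eta> $ k) *\<^sub>R (axis k 1, 0) + Im (\<eta> $ k) *\<^sub>R (axis k \<i>, 0))"
    by (subst *) (simp add: prod_eq_iff fst_sum snd_sum)
qed

lemma dir_deriv_fibre:
  fixes x :: "'n::finite coords"
  assumes "f differentiable (at x)"
  shows "dir_deriv (0, \<eta>) f x = (\<Sum>k\<in>UNIV. \<eta> $ k * deta k f x + cnj (\<eta> $ k) * detabar k f x)"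
proof -
  have lin: "linear (frechet_derivative f (at x))" by (rule linear_frechet_derivative[OF assms])
  have "dir_deriv (0, \<eta>) f x = (\<Sum>k\<in>UNIV. Re (\<eta> $ k) *\<^sub>R dir_deriv (0, axis k 1) f x + Im (\<eta> $ k) *\<^sub>R dir_deriv (0, axis k \<i>) f x)"
    by (subst vec_real_decomp) (simp only: linear_sum[OF lin] linear_add[OF lin] linear_scale[OF lin])
  also have "\<dots> = (\<Sum>k\<in>UNIV. \<eta> $ k * deta k f x + cnj (\<eta> $ k) * detabar k f x)"
    by (intro sum.cong refl) (simp add: deta_def detabar_def complex_eq_iff field_simps)
  finally show ?thesis .
qed

lemma dir_deriv_base:
  fixes x :: "'n::finite coords"
  assumes "f differentiable (at x)"
  shows "dir_deriv (\<zeta>, 0) f x = (\<Sum>k\<in>UNIV. \<zeta> $ k * dz k f x + cnj (\<zeta> $ k) * dzbar k f x)"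
proof -
  have lin: "linear (frechet_derivative f (at x))" by (rule linear_frechet_derivative[OF assms])
  have "dir_deriv (\<zeta>, 0) f x = (\<Sum>k\<in>UNIV. Re (\<zeta> $ k) *\<^sub>R dir_deriv (axis k 1, 0) f x + Im (\<zeta> $ k) *\<^sub>R dir_deriv (axis k \<i>, 0) f x)"
    by (subst vec_real_decomp) (simp only: linear_sum[OF lin] linear_add[OF lin] linear_scale[OF lin])
  also have "\<dots> = (\<Sum>k\<in>UNIV. \<zeta> $ k * dz k f x + cnj (\<zeta> $ k) * dzbar k f x)"
    by (intro sum.cong refl) (simp add: dz_def dzbar_def complex_eq_iff field_simps)
  finally show ?thesis .
qed


section \<open>The Chern--Finsler connection in a chart\<close>

lemma smooth_on_det:
  fixes G :: "'a::real_normed_vector \<Rightarrow> 'b::real_normed_field ^'n::finite^'n"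
  assumes "open S" "\<And>i j. smooth_on S (\<lambda>x. G x $ i $ j)"
  shows "smooth_on S (\<lambda>x. det (G x))"
  unfolding det_def by (intro smooth_on_sum smooth_on_mult smooth_on_prod smooth_on_const assms)

text \<open>The coordinate form of a Finsler metric over one chart: \<open>U\<close> will be a chart
  image and \<open>S\<close> the corresponding \<open>slit_coords\<close>. All differential geometry
  takes place here, and the manifold enters only for the global argument.\<close>

locale finsler_chart =
  fixes U :: "(complex^'n::finite) set" and L :: "'n coords \<Rightarrow> real" and S :: "'n coords set"
  defines "S \<equiv> U \<times> (UNIV - {0})"
  assumes open_base: "open U"
    and L_smooth: "smooth_on S L"
    and L_homogeneous: "(z, \<eta>) \<in> S \<Longrightarrow> L (z, a *s \<eta>) = (cmod a)\<^sup>2 * L (z, \<eta>)"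
    and pos_def: "x \<in> S \<Longrightarrow> hermitian_pos_def (\<chi> i j. fund_tensor L i j x)"
begin

abbreviation "g \<equiv> fund_tensor L"
abbreviation "gi \<equiv> fund_inverse L"
abbreviation "N \<equiv> nonlinear_conn L"
abbreviation "\<delta> \<equiv> hdel L"
abbreviation "\<delta>b \<equiv> hdelbar L"
abbreviation \<eta> :: "'n \<Rightarrow> 'n coords \<Rightarrow> complex" where "\<eta> k x \<equiv> snd x $ k"
abbreviation Lc :: "'n coords \<Rightarrow> complex" where "Lc x \<equiv> complex_of_real (L x)"
abbreviation "Lb m \<equiv> detabar m Lc"

lemma open_S: "open S"
proof -
  have "UNIV - {0::complex^'n} = - {0}" by auto
  then show ?thesis unfolding S_def by (intro open_Times open_base) (auto simp: open_Compl)
qed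

lemmas smooth_intros = smooth_on_const smooth_on_add[OF open_S] smooth_on_mult[OF open_S]
  smooth_on_diff[OF open_S] smooth_on_minus[OF open_S] smooth_on_sum[OF open_S]
  smooth_on_cnj[OF open_S]

sublocale dz: derivation S "dz k" for k
  unfolding dz_wirtinger by (rule derivation_wirtinger[OF open_S])
sublocale dzbar: derivation S "dzbar k" for k
  unfolding dzbar_wirtinger by (rule derivation_wirtinger[OF open_S])
sublocale deta: derivation S "deta k" for k
  unfolding deta_wirtinger by (rule derivation_wirtinger[OF open_S])
sublocale detabar: derivation S "detabar k" for k
  unfolding detabar_wirtinger by (rule derivation_wirtinger[OF open_S])

lemma smooth_Lc: "smooth_on S Lc"
  by (rule smooth_on_of_real[OF open_S L_smooth])

lemma smooth_Lb: "smooth_on S (Lb m)"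
  by (rule detabar.smooth[OF smooth_Lc])

lemma smooth_eta: "smooth_on S (\<eta> k)"
  by (rule smooth_on_linear[OF bounded_linear_fibre_coord open_S])

lemma smooth_g: "smooth_on S (g i j)"
  unfolding fund_tensor_def by (rule deta.smooth[OF smooth_Lb])

section \<open>The fundamental tensor and its inverse\<close>

lemma g_hermitian: "x \<in> S \<Longrightarrow> cnj (g i j x) = g j i x"
  using pos_def[of x] unfolding hermitian_pos_def_def vec_lambda_beta by metis

lemma g_invertible:
  assumes "x \<in> S" shows "invertible (\<chi> i j. g i j x)"
proof -
  let ?G = "\<chi> i j. g i j x"
  have "w = 0" if w: "?G *v w = 0" for w
  proof (rule ccontr)
    assume "w \<noteq> 0"
    \<comment> \<open>The Hermitian form conjugates its second argument, so a kernel vector w is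
      tested against its conjugate.\<close>
    define v where "v = (\<chi> i. cnj (w $ i))"
    have "v \<noteq> 0" using \<open>w \<noteq> 0\<close> by (auto simp: v_def vec_eq_iff)
    then have "0 < Re (\<Sum>i\<in>UNIV. \<Sum>j\<in>UNIV. ?G $ i $ j * v $ i * cnj (v $ j))"
      using pos_def[OF assms] unfolding hermitian_pos_def_def by blast
    also have "(\<Sum>i\<in>UNIV. \<Sum>j\<in>UNIV. ?G $ i $ j * v $ i * cnj (v $ j)) = (\<Sum>i\<in>UNIV. v $ i * (?G *v w) $ i)"
      by (simp add: matrix_vector_mult_def v_def sum_distrib_left mult_ac)
    finally show False using w by simp
  qed
  then show ?thesis
    using matrix_left_invertible_ker[of ?G] invertible_left_inverse by blast
qed

lemma g_inverse:
  assumes "x \<in> S"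
  shows "(\<Sum>m\<in>UNIV. g a m x * gi m b x) = (if a = b then 1 else 0)"
    and "(\<Sum>a\<in>UNIV. gi m a x * g a l x) = (if m = l then 1 else 0)"
proof -
  let ?G = "\<chi> i j. g i j x"
  have "?G ** matrix_inv ?G = mat 1 \<and> matrix_inv ?G ** ?G = mat 1"
    using g_invertible[OF assms] unfolding invertible_def matrix_inv_def by (rule someI_ex)
  then have "(?G ** matrix_inv ?G) $ a $ b = (if a = b then 1 else 0)"
    "(matrix_inv ?G ** ?G) $ m $ l = (if m = l then 1 else 0)"
    by (auto simp: mat_def)
  then show "(\<Sum>m\<in>UNIV. g a m x * gi m b x) = (if a = b then 1 else 0)"
    "(\<Sum>a\<in>UNIV. gi m a x * g a l x) = (if m = l then 1 else 0)"
    by (simp_all add: matrix_matrix_mult_def fund_inverse_def)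
qed

lemma raise_index:
  assumes "x \<in> S" "\<And>m. (\<Sum>k\<in>UNIV. g k m x * X k) = Y m"
  shows "X k = (\<Sum>m\<in>UNIV. gi m k x * Y m)"
proof -
  have "(\<Sum>m\<in>UNIV. gi m k x * Y m) = (\<Sum>m\<in>UNIV. \<Sum>l\<in>UNIV. (g l m x * gi m k x) * X l)"
    by (simp add: assms(2)[symmetric] sum_distrib_left mult_ac)
  also have "\<dots> = (\<Sum>l\<in>UNIV. (\<Sum>m\<in>UNIV. g l m x * gi m k x) * X l)"
    by (subst sum.swap) (simp add: sum_distrib_right)
  also have "\<dots> = X k"
    by (simp add: g_inverse[OF assms(1)] if_distrib[of "\<lambda>t. t * _"] cong: if_cong)
  finally show ?thesis by simp
qed

lemma lower_index:
  assumes "x \<in> S" "\<And>k. X k = (\<Sum>m\<in>UNIV. gi m k x * Y m)"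
  shows "(\<Sum>k\<in>UNIV. g k l x * X k) = Y l"
proof -
  have "(\<Sum>k\<in>UNIV. g k l x * X k) = (\<Sum>k\<in>UNIV. \<Sum>m\<in>UNIV. (gi m k x * g k l x) * Y m)"
    by (simp add: assms(2) sum_distrib_left mult_ac)
  also have "\<dots> = (\<Sum>m\<in>UNIV. (\<Sum>k\<in>UNIV. gi m k x * g k l x) * Y m)"
    by (subst sum.swap) (simp add: sum_distrib_right)
  also have "\<dots> = Y l"
    by (simp add: g_inverse[OF assms(1)] if_distrib[of "\<lambda>t. t * _"] cong: if_cong)
  finally show ?thesis .
qed

lemma lower_index_zero:
  assumes "x \<in> S" "\<And>m. (\<Sum>k\<in>UNIV. g k m x * X k) = 0"
  shows "X k = 0"
  using raise_index[OF assms] by simp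

text \<open>\<open>matrix_inv\<close> is defined by choice, which says nothing about smoothness.
  Cramer's rule rewrites each entry as a quotient of determinants of smooth matrices.\<close>

lemma smooth_gi: "smooth_on S (gi m k)"
proof -
  define G where "G x = (\<chi> i j. g i j x)" for x
  \<comment> \<open>The metric with column m replaced by a unit vector, which is the numerator
    matrix in Cramer's rule.\<close>
  define C where "C x = (\<chi> a b. if b = m then axis k 1 $ a else G x $ a $ b)" for x :: "'n coords"
  have nz: "det (G x) \<noteq> 0" if "x \<in> S" for x
    using g_invertible[OF that] by (simp add: invertible_det_nz G_def)
  have sm: "smooth_on S (\<lambda>x. det (G x))" "smooth_on S (\<lambda>x. det (C x))"
  proof -
    show "smooth_on S (\<lambda>x. det (G x))" by (intro smooth_on_det open_S) (simp add: G_def smooth_g)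
    have "smooth_on S (\<lambda>x. C x $ i $ j)" for i j
      by (cases "j = m") (simp_all add: C_def G_def smooth_g smooth_on_const)
    then show "smooth_on S (\<lambda>x. det (C x))" by (intro smooth_on_det open_S)
  qed
  have "gi m k x = det (C x) / det (G x)" if x: "x \<in> S" for x
  proof -
    have "G x *v (\<chi> m. gi m k x) = axis k 1"
      by (auto simp: vec_eq_iff matrix_vector_mult_def G_def axis_def g_inverse[OF x])
    then have "(\<chi> m. gi m k x) = (\<chi> m. det (\<chi> a b. if b = m then axis k 1 $ a else G x $ a $ b) / det (G x))"
      using cramer[OF nz[OF x]] by blast
    then show ?thesis by (simp add: vec_eq_iff C_def)
  qed
  then show ?thesis
    using smooth_on_divide[OF open_S nz sm(2,1)] smooth_on_cong[OF open_S, of "gi m k" "\<lambda>x. det (C x) / det (G x)"]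
    by simp
qed

section \<open>Smoothness of the nonlinear connection, and the horizontal operators as
  derivations\<close>

lemma smooth_N: "smooth_on S (N k j)"
proof -
  have "N k j = (\<lambda>x. \<Sum>m\<in>UNIV. \<Sum>l\<in>UNIV. gi m k x * dz j (g l m) x * \<eta> l x)"
    by (rule ext) (simp add: nonlinear_conn_def)
  then show ?thesis
    by (auto intro!: smooth_intros smooth_gi smooth_eta dz.smooth smooth_g)
qed

sublocale \<delta>: derivation S "\<delta> k" for k
proof -
  have "derivation S (\<lambda>f x. 1 * dz k f x + (- 1) * (\<Sum>j\<in>UNIV. N j k x * deta j f x))"
    by (intro derivation_lincomb derivation_sum open_S smooth_N smooth_on_const) unfold_locales
  moreover have "(\<lambda>f x. 1 * dz k f x + (- 1) * (\<Sum>j\<in>UNIV. N j k x * deta j f x)) = \<delta> k"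
    by (intro ext) (simp add: hdel_def)
  ultimately show "derivation S (\<delta> k)" by simp
qed

sublocale \<delta>b: derivation S "\<delta>b k" for k
proof -
  have "derivation S (\<lambda>f x. 1 * dzbar k f x + (- 1) * (\<Sum>j\<in>UNIV. cnj (N j k x) * detabar j f x))"
    by (intro derivation_lincomb derivation_sum open_S smooth_N smooth_on_const smooth_intros) unfold_locales
  moreover have "(\<lambda>f x. 1 * dzbar k f x + (- 1) * (\<Sum>j\<in>UNIV. cnj (N j k x) * detabar j f x)) = \<delta>b k"
    by (intro ext) (simp add: hdelbar_def)
  ultimately show "derivation S (\<delta>b k)" by simp
qed

lemma hdelbar_cnj: "smooth_on S f \<Longrightarrow> x \<in> S \<Longrightarrow> \<delta>b k (\<lambda>x. cnj (f x)) x = cnj (\<delta> k f x)"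
  using smooth_on_differentiable[of S f x] by (simp add: hdelbar_def hdel_def dzbar_cnj detabar_cnj)

lemma hdel_eta: "\<delta> k (\<eta> j) x = - N j k x" "\<delta> k (\<lambda>x. cnj (\<eta> j x)) x = 0"
  "\<delta>b k (\<eta> j) x = 0"
  by (simp_all add: hdel_def hdelbar_def fibre_coord_derivs fibre_coord_cnj_derivs
      if_distrib[of "\<lambda>t. _ * t"] cong: if_cong)

section \<open>Euler identities from complex homogeneity\<close>

lemma
  assumes x: "x \<in> S"
  shows euler: "(\<Sum>k\<in>UNIV. \<eta> k x * deta k Lc x) = Lc x"
    and euler_cnj: "(\<Sum>k\<in>UNIV. cnj (\<eta> k x) * Lb k x) = Lc x"
proof -
  obtain z v where zv: "x = (z, v)" by force
  have dLc: "(Lc has_derivative frechet_derivative Lc (at x)) (at x)"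
    by (rule smooth_on_has_derivative[OF smooth_Lc x])
  \<comment> \<open>Homogeneity gives L(z, (1 + t a) v) = |1 + t a|^2 L(z, v), and this is the
    derivative at t = 0. The choices a = 1 and a = \<i> then yield the sum and the difference of the
    two contractions.\<close>
  have A: "dir_deriv (0, a *s v) Lc x = 2 * complex_of_real (Re a) * Lc x" for a
  proof -
    define l where "l t = (z, v + t *\<^sub>R (a *s v))" for t :: real
    have l0: "l 0 = x" by (simp add: l_def zv)
    have "(l has_derivative (\<lambda>t. (0, t *\<^sub>R (a *s v)))) (at 0)"
      unfolding l_def[abs_def] by (auto intro!: derivative_eq_intros)
    from has_derivative_compose[OF this, of Lc "frechet_derivative Lc (at x)"]
    have "((\<lambda>t. Lc (l t)) has_derivative (\<lambda>t. dir_deriv (0, t *\<^sub>R (a *s v)) Lc x)) (at 0)"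
      using dLc by (simp add: l0)
    then have 1: "((\<lambda>t. Lc (l t)) has_vector_derivative dir_deriv (0, a *s v) Lc x) (at 0)"
      unfolding has_vector_derivative_def
      using linear_scale[OF linear_frechet_derivative[OF smooth_on_differentiable[OF smooth_Lc x]], of _ "(0, a *s v)"]
      by simp
    have "Lc (l t) = complex_of_real ((1 + t * Re a)\<^sup>2 + (t * Im a)\<^sup>2) * Lc x" for t
    proof -
      have "v + t *\<^sub>R (a *s v) = (1 + of_real t * a) *s v"
        by (simp add: vec_eq_iff algebra_simps scaleR_conv_of_real[where 'a=complex])
      then have "L (l t) = (cmod (1 + of_real t * a))\<^sup>2 * L x"
        using L_homogeneous[of z v "1 + of_real t * a"] x by (simp add: l_def zv)
      then show ?thesis by (simp add: cmod_power2)
    qed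
    moreover have "((\<lambda>t. complex_of_real ((1 + t * Re a)\<^sup>2 + (t * Im a)\<^sup>2) * Lc x)
        has_vector_derivative 2 * complex_of_real (Re a) * Lc x) (at 0)"
      unfolding has_vector_derivative_def
      by (auto intro!: derivative_eq_intros simp: scaleR_conv_of_real)
    ultimately have "((\<lambda>t. Lc (l t)) has_vector_derivative 2 * complex_of_real (Re a) * Lc x) (at 0)"
      by simp
    with 1 show ?thesis by (rule vector_derivative_unique_at)
  qed
  have dir: "dir_deriv (0, a *s v) Lc x =
      a * (\<Sum>k\<in>UNIV. \<eta> k x * deta k Lc x) + cnj a * (\<Sum>k\<in>UNIV. cnj (\<eta> k x) * Lb k x)" for a
    by (subst dir_deriv_fibre[OF smooth_on_differentiable[OF smooth_Lc x]])
      (simp add: sum.distrib sum_distrib_left zv mult_ac)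
  let ?P = "\<Sum>k\<in>UNIV. \<eta> k x * deta k Lc x" and ?Q = "\<Sum>k\<in>UNIV. cnj (\<eta> k x) * Lb k x"
  have "?P + ?Q = 2 * Lc x" using A[of 1] dir[of 1] by simp
  moreover have "?P = ?Q" using A[of \<i>] dir[of \<i>] by simp
  ultimately show "?P = Lc x" "?Q = Lc x" by auto
qed

lemma euler_g:
  assumes x: "x \<in> S"
  shows "(\<Sum>k\<in>UNIV. \<eta> k x * g k j x) = Lb j x"
proof -
  have "Lb j x = detabar j (\<lambda>x. \<Sum>k\<in>UNIV. \<eta> k x * deta k Lc x) x"
    by (rule detabar.cong[OF x]) (simp add: euler)
  also have "\<dots> = (\<Sum>k\<in>UNIV. \<eta> k x * detabar j (deta k Lc) x)"
    by (subst detabar.sum_mult[OF open_S])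
      (auto simp: fibre_coord_derivs x smooth_eta deta.smooth smooth_Lc)
  also have "\<dots> = (\<Sum>k\<in>UNIV. \<eta> k x * g k j x)"
    unfolding fund_tensor_def deta_wirtinger detabar_wirtinger
    by (subst wirtinger_commute[OF open_S smooth_Lc x]) rule
  finally show ?thesis by simp
qed

lemma euler_cnj_g:
  assumes x: "x \<in> S"
  shows "(\<Sum>k\<in>UNIV. cnj (\<eta> k x) * g j k x) = deta j Lc x"
proof -
  have "deta j Lc x = deta j (\<lambda>x. \<Sum>k\<in>UNIV. cnj (\<eta> k x) * Lb k x) x"
    by (rule deta.cong[OF x]) (simp add: euler_cnj)
  also have "\<dots> = (\<Sum>k\<in>UNIV. cnj (\<eta> k x) * g j k x)"
    by (subst deta.sum_mult[OF open_S])
      (auto simp: fibre_coord_cnj_derivs x smooth_eta smooth_intros smooth_Lb fund_tensor_def)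
  finally show ?thesis by simp
qed

lemma deta_g_sym:
  assumes "x \<in> S" shows "deta i (g k j) x = deta k (g i j) x"
  unfolding fund_tensor_def deta_wirtinger by (rule wirtinger_commute[OF open_S smooth_Lb assms])

text \<open>In the \<eta>^i derivative of \<open>euler_g\<close> the term in which \<eta> is
  differentiated reproduces \<open>g i j\<close>, so the rest must vanish.\<close>

lemma euler_deta_g:
  assumes x: "x \<in> S"
  shows "(\<Sum>k\<in>UNIV. \<eta> k x * deta i (g k j) x) = 0"
proof -
  have "g i j x = deta i (\<lambda>x. \<Sum>k\<in>UNIV. \<eta> k x * g k j x) x"
    unfolding fund_tensor_def[of _ i j] using euler_g by (intro deta.cong[OF x]) simp
  also have "\<dots> = g i j x + (\<Sum>k\<in>UNIV. \<eta> k x * deta i (g k j) x)"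
    by (subst deta.sum_mult[OF open_S])
      (auto simp: fibre_coord_derivs x smooth_eta smooth_g if_distrib[of "\<lambda>t. t * _"] cong: if_cong)
  finally show ?thesis by simp
qed

text \<open>The analogue for conjugate \<eta>. Its horizontal derivative is what eliminates the
  uncontrolled commutator term in \<open>detabar_N_contracted\<close>.\<close>

lemma euler_detabar_Lb:
  assumes x: "x \<in> S"
  shows "(\<Sum>k\<in>UNIV. cnj (\<eta> k x) * detabar l (Lb k) x) = 0"
proof -
  have "Lb l x = detabar l (\<lambda>x. \<Sum>k\<in>UNIV. cnj (\<eta> k x) * Lb k x) x"
    by (rule detabar.cong[OF x]) (simp add: euler_cnj)
  also have "\<dots> = Lb l x + (\<Sum>k\<in>UNIV. cnj (\<eta> k x) * detabar l (Lb k) x)"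
    by (subst detabar.sum_mult[OF open_S])
      (auto simp: fibre_coord_cnj_derivs x smooth_eta smooth_intros smooth_Lb if_distrib[of "\<lambda>t. t * _"] cong: if_cong)
  finally show ?thesis by simp
qed

lemma L_pos:
  assumes x: "x \<in> S" shows "0 < L x"
proof -
  have "snd x \<noteq> 0" using x by (auto simp: S_def)
  then have "0 < Re (\<Sum>i\<in>UNIV. \<Sum>j\<in>UNIV. g i j x * \<eta> i x * cnj (\<eta> j x))"
    using pos_def[OF x] unfolding hermitian_pos_def_def vec_lambda_beta by blast
  moreover have "(\<Sum>j\<in>UNIV. g i j x * \<eta> i x * cnj (\<eta> j x)) = \<eta> i x * deta i Lc x" for i
    unfolding euler_cnj_g[OF x, symmetric] sum_distrib_left by (intro sum.cong refl) simp
  ultimately show ?thesis by (simp add: euler[OF x])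
qed

section \<open>Derivatives of the nonlinear connection, and commutators of the horizontal
  operators\<close>

lemma lower_N:
  assumes x: "x \<in> S"
  shows "(\<Sum>k\<in>UNIV. g k m x * N k j x) = dz j (Lb m) x"
proof (rule lower_index[OF x])
  fix k
  have "dz j (Lb m) x = (\<Sum>l\<in>UNIV. dz j (g l m) x * \<eta> l x)" for m
  proof -
    have "dz j (Lb m) x = dz j (\<lambda>x. \<Sum>l\<in>UNIV. \<eta> l x * g l m x) x"
      by (rule dz.cong[OF x]) (simp add: euler_g)
    also have "\<dots> = (\<Sum>l\<in>UNIV. dz j (g l m) x * \<eta> l x)"
      by (subst dz.sum_mult[OF open_S]) (auto simp: fibre_coord_derivs x smooth_eta smooth_g mult.commute)
    finally show ?thesis .
  qed
  then show "N k j x = (\<Sum>m\<in>UNIV. gi m k x * dz j (Lb m) x)"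
    by (simp add: nonlinear_conn_def sum_distrib_left mult.assoc)
qed

text \<open>This identity characterises \<open>N\<close>; all properties of the connection below are obtained by
  differentiating it.\<close>
lemma hdel_Lb: "x \<in> S \<Longrightarrow> \<delta> j (Lb m) x = 0"
  using lower_N[of x m j] by (simp add: hdel_def fund_tensor_def mult.commute)

text \<open>Coordinate derivatives commute with one another, so only the coefficients N of \<delta>
  contribute to the commutator.\<close>

lemma wirtinger_hdel:
  assumes f: "smooth_on S f" and x: "x \<in> S"
  shows "wirtinger a b c (\<delta> j f) x =
    \<delta> j (wirtinger a b c f) x - (\<Sum>k\<in>UNIV. wirtinger a b c (N k j) x * deta k f x)"
proof -
  interpret T: derivation S "wirtinger a b c" by (rule derivation_wirtinger[OF open_S])
  have comm: "wirtinger a b c (dz j f) x = dz j (wirtinger a b c f) x"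
    "wirtinger a b c (deta k f) x = deta k (wirtinger a b c f) x" for k
    unfolding dz_wirtinger deta_wirtinger by (rule wirtinger_commute[OF open_S f x])+
  have "wirtinger a b c (\<delta> j f) x = wirtinger a b c (\<lambda>x. dz j f x - (\<Sum>k\<in>UNIV. N k j x * deta k f x)) x"
    by (rule T.cong[OF x]) (simp add: hdel_def)
  also have "\<dots> = wirtinger a b c (dz j f) x - (\<Sum>k\<in>UNIV. N k j x * wirtinger a b c (deta k f) x)
      - (\<Sum>k\<in>UNIV. wirtinger a b c (N k j) x * deta k f x)"
    by (subst T.diff[OF open_S _ _ x], auto intro!: dz.smooth deta.smooth f smooth_intros smooth_N)
      (subst T.sum_mult[OF open_S], auto intro!: deta.smooth f smooth_N x)
  finally show ?thesis by (simp add: hdel_def comm)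
qed

text \<open>In the \<eta>^i derivative of \<open>hdel_Lb\<close> the commutator is contracted with
  \<open>deta k (Lb m)\<close>, which is the metric. The conjugate version follows in the same way;
  raising the index here identifies \<open>conn_L\<close> with a fibre derivative of N.\<close>

lemma lower_deta_N:
  assumes x: "x \<in> S"
  shows "(\<Sum>k\<in>UNIV. g k m x * deta i (N k j) x) = \<delta> j (g i m) x"
proof -
  have "0 = deta i (\<delta> j (Lb m)) x"
    using deta.const_on[OF x, of "\<delta> j (Lb m)" 0 i] hdel_Lb by simp
  then show ?thesis
    using wirtinger_hdel[OF smooth_Lb x, of "(0, axis i 1)" "(0, axis i \<i>)" "-\<i>" j m]
    unfolding deta_wirtinger[symmetric] fund_tensor_def by (simp add: mult.commute)
qed

lemma lower_detabar_N:
  assumes x: "x \<in> S"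
  shows "(\<Sum>k\<in>UNIV. g k m x * detabar l (N k j) x) = \<delta> j (detabar l (Lb m)) x"
proof -
  have "0 = detabar l (\<delta> j (Lb m)) x"
    using detabar.const_on[OF x, of "\<delta> j (Lb m)" 0 l] hdel_Lb by simp
  then show ?thesis
    using wirtinger_hdel[OF smooth_Lb x, of "(0, axis l 1)" "(0, axis l \<i>)" "\<i>" j m]
    unfolding detabar_wirtinger[symmetric] fund_tensor_def by (simp add: mult.commute)
qed

lemma conn_L_eq:
  assumes x: "x \<in> S"
  shows "conn_L L i j k x = deta j (N i k) x"
  using raise_index[where X = "\<lambda>i. deta j (N i k) x" and Y = "\<lambda>m. \<delta> k (g j m) x", OF x lower_deta_N[OF x]]
  by (simp add: conn_L_def)

text \<open>Everything in the iterated derivative that does not differentiate N is symmetric, so the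
  commutator is a purely vertical operator.\<close>

lemma hdel_commutator:
  assumes f: "smooth_on S f" and x: "x \<in> S"
  shows "\<delta> l (\<delta> k f) x - \<delta> k (\<delta> l f) x = - (\<Sum>j\<in>UNIV. (\<delta> l (N j k) x - \<delta> k (N j l) x) * deta j f x)"
proof -
  \<comment> \<open>The part without derivatives of N. It is symmetric in l and k because coordinate
    derivatives commute.\<close>
  define B where "B l k = dz l (dz k f) x - (\<Sum>j\<in>UNIV. N j l x * dz k (deta j f) x) - (\<Sum>j\<in>UNIV. N j k x * dz l (deta j f) x)
    + (\<Sum>j\<in>UNIV. \<Sum>i\<in>UNIV. N j k x * N i l x * deta i (deta j f) x)" for l k
  have dd: "dz l (dz k f) x = dz k (dz l f) x" "deta j (dz k f) x = dz k (deta j f) x"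
    "deta j (deta i f) x = deta i (deta j f) x" for l k i j
    unfolding dz_wirtinger deta_wirtinger by (rule wirtinger_commute[OF open_S f x])+
  have *: "\<delta> l (\<delta> k f) x = B l k - (\<Sum>j\<in>UNIV. \<delta> l (N j k) x * deta j f x)" for l k
  proof -
    have "\<delta> l (\<delta> k f) x = \<delta> l (\<lambda>x. dz k f x - (\<Sum>j\<in>UNIV. N j k x * deta j f x)) x"
      by (rule \<delta>.cong[OF x]) (simp add: hdel_def)
    also have "\<dots> = \<delta> l (dz k f) x - (\<Sum>j\<in>UNIV. \<delta> l (N j k) x * deta j f x) - (\<Sum>j\<in>UNIV. N j k x * \<delta> l (deta j f) x)"
      by (subst \<delta>.diff[OF open_S _ _ x], auto intro!: dz.smooth deta.smooth f smooth_intros smooth_N)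
        (subst \<delta>.sum_mult[OF open_S], auto intro!: deta.smooth f smooth_N x)
    also have "\<dots> = B l k - (\<Sum>j\<in>UNIV. \<delta> l (N j k) x * deta j f x)"
      by (simp add: B_def hdel_def[of _ _ "dz k f"] hdel_def[of _ _ "deta _ f"] dd(2)
          sum_subtractf sum_distrib_left algebra_simps)
    finally show ?thesis .
  qed
  have "(\<Sum>j\<in>UNIV. \<Sum>i\<in>UNIV. N j k x * N i l x * deta i (deta j f) x) =
     (\<Sum>j\<in>UNIV. \<Sum>i\<in>UNIV. N j l x * N i k x * deta i (deta j f) x)"
    by (subst sum.swap) (simp add: dd(3) mult_ac)
  then have "B l k = B k l" by (simp add: B_def dd(1)[of l k])
  then show ?thesis by (simp add: * left_diff_distrib sum_subtractf)
qed

text \<open>The commutator is tested on \<open>Lb m\<close>. Both iterated derivatives vanish by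
  \<open>hdel_Lb\<close>, and what remains is the metric contracted with the antisymmetric part in
  question; the metric is nondegenerate.\<close>

lemma hdel_N_sym:
  assumes x: "x \<in> S" shows "\<delta> l (N i k) x = \<delta> k (N i l) x"
proof -
  have 0: "\<delta> l (\<delta> k (Lb m)) x = 0" for l k m
    using \<delta>.const_on[OF x, of "\<delta> k (Lb m)" 0 l] hdel_Lb by simp
  have "(\<Sum>j\<in>UNIV. g j m x * (\<delta> l (N j k) x - \<delta> k (N j l) x)) = 0" for m
    using hdel_commutator[OF smooth_Lb x, of l k m] by (simp add: 0 fund_tensor_def mult.commute)
  from lower_index_zero[OF x this] show ?thesis by simp
qed

text \<open>By \<open>hdel_N_sym\<close> the vertical remainder in \<open>hdel_commutator\<close> is
  zero, and conjugation carries this over to the barred operators.\<close>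

lemma hdelbar_commute:
  assumes f: "smooth_on S f" and x: "x \<in> S"
  shows "\<delta>b l (\<delta>b k f) x = \<delta>b k (\<delta>b l f) x"
proof -
  let ?f = "\<lambda>x. cnj (f x)"
  have sm: "smooth_on S ?f" by (intro smooth_intros f)
  have 1: "\<delta>b k f y = cnj (\<delta> k ?f y)" if "y \<in> S" for k y
    using hdelbar_cnj[OF sm that, of k] by simp
  have "\<delta>b l (\<delta>b k f) x = \<delta>b l (\<lambda>y. cnj (\<delta> k ?f y)) x" for l k
    by (rule \<delta>b.cong[OF x 1])
  then have "\<delta>b l (\<delta>b k f) x = cnj (\<delta> l (\<delta> k ?f) x)" for l k
    by (simp add: hdelbar_cnj[OF \<delta>.smooth[OF sm] x])
  then show ?thesis
    using hdel_commutator[OF sm x, of l k] by (simp add: hdel_N_sym[OF x])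
qed

section \<open>Contraction of the connection and the curvature with \<eta>\<close>

lemma smooth_conn_L: "smooth_on S (conn_L L i j k)"
  using smooth_on_cong[OF open_S, of "conn_L L i j k" "deta j (N i k)"] conn_L_eq deta.smooth[OF smooth_N]
  by simp

text \<open>Apply \<open>\<delta> k\<close> to \<open>euler_g\<close>: the left side is killed by
  \<open>hdel_Lb\<close>, and differentiating \<eta> produces -N.\<close>

lemma conn_L_eta:
  assumes x: "x \<in> S"
  shows "(\<Sum>j\<in>UNIV. \<eta> j x * conn_L L i j k x) = N i k x"
proof -
  have "(\<Sum>j\<in>UNIV. g j m x * N j k x) = (\<Sum>j\<in>UNIV. \<eta> j x * \<delta> k (g j m) x)" for m
  proof -
    have "0 = \<delta> k (\<lambda>x. \<Sum>j\<in>UNIV. \<eta> j x * g j m x) x"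
      using \<delta>.cong[OF x, of "Lb m" "\<lambda>x. \<Sum>j\<in>UNIV. \<eta> j x * g j m x" k] hdel_Lb[OF x] euler_g by simp
    then show ?thesis
      by (subst (asm) \<delta>.sum_mult[OF open_S])
        (auto simp: hdel_eta x smooth_eta smooth_g sum_negf mult.commute)
  qed
  from raise_index[OF x this, of i]
  show ?thesis
    by (simp add: conn_L_def sum_distrib_left mult.left_commute) (subst sum.swap, simp)
qed

text \<open>The first contraction is \<open>euler_deta_g\<close> with an index raised; the second
  follows from it because the two lower indices are symmetric.\<close>

lemma conn_C_eta:
  assumes x: "x \<in> S"
  shows "(\<Sum>j\<in>UNIV. \<eta> j x * conn_C L i j k x) = 0" "(\<Sum>k\<in>UNIV. \<eta> k x * conn_C L i j k x) = 0"
proof -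
  have "(\<Sum>j\<in>UNIV. \<eta> j x * conn_C L i j k x) = (\<Sum>l\<in>UNIV. gi l i x * (\<Sum>j\<in>UNIV. \<eta> j x * deta k (g j l) x))" for k
    by (simp add: conn_C_def sum_distrib_left mult.left_commute) (subst sum.swap, simp)
  then show 1: "(\<Sum>j\<in>UNIV. \<eta> j x * conn_C L i j k x) = 0" for k by (simp add: euler_deta_g[OF x])
  have "conn_C L i j k x = conn_C L i k j x" for k j
    by (simp add: conn_C_def deta_g_sym[OF x, of k])
  then show "(\<Sum>k\<in>UNIV. \<eta> k x * conn_C L i j k x) = 0" using 1[of j] by simp
qed

text \<open>The barred \<delta> annihilates \<eta>, so \<eta> can be moved inside it, where it turns
  \<open>conn_L\<close> into N. The term with \<open>conn_C\<close> drops out.\<close>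

lemma curvature_eta:
  assumes x: "x \<in> S"
  shows "(\<Sum>j\<in>UNIV. \<eta> j x * curvature L i j h k x) = - \<delta>b h (N i k) x"
proof -
  have "\<delta>b h (N i k) x = \<delta>b h (\<lambda>x. \<Sum>j\<in>UNIV. \<eta> j x * conn_L L i j k x) x"
    by (rule \<delta>b.cong[OF x]) (simp add: conn_L_eta)
  also have "\<dots> = (\<Sum>j\<in>UNIV. \<eta> j x * \<delta>b h (conn_L L i j k) x)"
    by (subst \<delta>b.sum_mult[OF open_S]) (auto simp: hdel_eta x smooth_eta smooth_conn_L)
  finally have 1: "(\<Sum>j\<in>UNIV. \<eta> j x * \<delta>b h (conn_L L i j k) x) = \<delta>b h (N i k) x" by simp
  have "(\<Sum>j\<in>UNIV. \<eta> j x * (\<Sum>l\<in>UNIV. \<delta>b h (N l k) x * conn_C L i j l x)) =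
     (\<Sum>l\<in>UNIV. \<delta>b h (N l k) x * (\<Sum>j\<in>UNIV. \<eta> j x * conn_C L i j l x))"
    by (simp add: sum_distrib_left mult.left_commute) (subst sum.swap, simp)
  then have 2: "(\<Sum>j\<in>UNIV. \<eta> j x * (\<Sum>l\<in>UNIV. \<delta>b h (N l k) x * conn_C L i j l x)) = 0"
    by (simp add: conn_C_eta[OF x])
  show ?thesis
    using 1 2 by (simp add: curvature_def right_diff_distrib sum_subtractf sum_negf)
qed


subsection \<open>Constant curvature\<close>

lemma wirtinger_hdelbar:
  assumes f: "smooth_on S f" and x: "x \<in> S"
  shows "wirtinger a b c (\<delta>b j f) x =
    \<delta>b j (wirtinger a b c f) x - (\<Sum>k\<in>UNIV. wirtinger a b c (\<lambda>x. cnj (N k j x)) x * detabar k f x)"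
proof -
  let ?f = "\<lambda>x. cnj (f x)" and ?W = "wirtinger a b c" and ?W' = "wirtinger a b (cnj c)"
  interpret W: derivation S ?W by (rule derivation_wirtinger[OF open_S])
  interpret W': derivation S ?W' by (rule derivation_wirtinger[OF open_S])
  note diff = smooth_on_differentiable
  have sm: "smooth_on S ?f" by (intro smooth_intros f)
  have "?W (\<delta>b j f) x = ?W (\<lambda>y. cnj (\<delta> j ?f y)) x"
    using hdelbar_cnj[OF sm, of _ j] by (intro W.cong[OF x]) simp
  also have "\<dots> = cnj (?W' (\<delta> j ?f) x)"
    by (rule wirtinger_cnj[OF diff[OF \<delta>.smooth[OF sm] x]])
  also have "\<dots> = cnj (\<delta> j (?W' ?f) x) - (\<Sum>k\<in>UNIV. cnj (?W' (N k j) x) * cnj (deta k ?f x))"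
    by (simp add: wirtinger_hdel[OF sm x])
  also have "cnj (\<delta> j (?W' ?f) x) = \<delta>b j (\<lambda>y. cnj (?W' ?f y)) x"
    by (rule hdelbar_cnj[OF W'.smooth[OF sm] x, symmetric])
  also have "\<dots> = \<delta>b j (?W f) x"
    using diff[OF f] by (intro \<delta>b.cong[OF x]) (simp add: wirtinger_cnj)
  finally show ?thesis
    using diff[OF f x] diff[OF smooth_N x] by (simp add: wirtinger_cnj deta_cnj)
qed

text \<open>The Wirtinger derivatives along the fibre determine the full real differential there,
  and the fibre without its origin is connected.\<close>

lemma constant_on_fibre:
  assumes f: "smooth_on S f" and z: "z \<in> U" "v \<noteq> 0" "v' \<noteq> 0"
    and 0: "\<And>w k. w \<noteq> 0 \<Longrightarrow> deta k f (z, w) = 0 \<and> detabar k f (z, w) = 0"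
  shows "f (z, v) = f (z, v')"
proof -
  have S: "(z, w) \<in> S" if "w \<noteq> 0" for w using that z by (simp add: S_def)
  have "((\<lambda>w. f (z, w)) has_derivative (\<lambda>u. 0)) (at w)" if "w \<noteq> 0" for w
  proof -
    have "((\<lambda>w. (z, w)) has_derivative (\<lambda>u. (0, u))) (at w)"
      by (auto intro!: derivative_eq_intros)
    from has_derivative_compose[OF this smooth_on_has_derivative[OF f S[OF that]]]
    show ?thesis
      using dir_deriv_fibre[OF smooth_on_differentiable[OF f S[OF that]]] 0[OF that] by simp
  qed
  \<comment> \<open>Removing a point preserves connectedness because the real dimension is at least
    2, already when the fibre is a complex line.\<close>
  moreover have "connected (UNIV - {0 :: complex^'n})"
    by (rule connected_open_delete) (auto simp: DIM_complex card_gt_0_iff Suc_le_eq intro!: le_trans[of 2 "2 * CARD('n)"])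
  moreover have "open (UNIV - {0 :: complex^'n})" by (simp add: open_delete)
  ultimately show ?thesis
    using has_derivative_zero_unique_connected[of "UNIV - {0}" "\<lambda>w. f (z, w)" v v'] z
    by simp
qed

section \<open>The curvature hypothesis and its consequences along the fibres\<close>

context
  fixes \<kappa> :: "'n coords \<Rightarrow> real"
  assumes curv: "\<And>x r j h k. x \<in> S \<Longrightarrow> curvature_low L r j h k x =
    complex_of_real (\<kappa> x) * (g j r x * g k h x + g k r x * g j h x)"
begin

abbreviation \<kappa>c :: "'n coords \<Rightarrow> complex" where "\<kappa>c x \<equiv> complex_of_real (\<kappa> x)"

lemma curvature_eq:
  assumes x: "x \<in> S"
  shows "curvature L i j h k x =
    \<kappa>c x * ((if i = j then g k h x else 0) + (if i = k then g j h x else 0))"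
proof -
  have "curvature L i j h k x = (\<Sum>r\<in>UNIV. gi r i x * (\<kappa>c x * (g j r x * g k h x + g k r x * g j h x)))"
    by (rule raise_index[where X = "\<lambda>i. curvature L i j h k x"
          and Y = "\<lambda>r. \<kappa>c x * (g j r x * g k h x + g k r x * g j h x)", OF x])
      (simp add: curv[OF x, symmetric] curvature_low_def)
  also have "\<dots> = \<kappa>c x * (g k h x * (\<Sum>r\<in>UNIV. g j r x * gi r i x) + g j h x * (\<Sum>r\<in>UNIV. g k r x * gi r i x))"
    by (simp add: sum_distrib_left sum.distrib algebra_simps)
  finally show ?thesis by (auto simp: g_inverse[OF x])
qed

lemma hdelbar_N:
  assumes x: "x \<in> S"
  shows "\<delta>b h (N i k) x = - (\<kappa>c x * (\<eta> i x * g k h x + (if i = k then Lb h x else 0)))"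
proof -
  have "(\<Sum>j\<in>UNIV. \<eta> j x * curvature L i j h k x) =
      \<kappa>c x * (\<Sum>j\<in>UNIV. (if i = j then \<eta> j x * g k h x else 0)) + \<kappa>c x * (if i = k then (\<Sum>j\<in>UNIV. \<eta> j x * g j h x) else 0)"
    unfolding sum_distrib_left by (auto simp: curvature_eq[OF x] sum_distrib_left sum.distrib[symmetric] algebra_simps intro!: sum.cong)
  then have "(\<Sum>j\<in>UNIV. \<eta> j x * curvature L i j h k x) =
      \<kappa>c x * (\<eta> i x * g k h x + (if i = k then Lb h x else 0))"
    by (simp add: euler_g[OF x] distrib_left)
  then show ?thesis using curvature_eta[OF x, of i h k] by (metis minus_minus)
qed

text \<open>\<kappa> is an arbitrary function here and its smoothness has to be extracted. In the
  trace of \<open>hdelbar_N\<close> over i = k the Kronecker term contributes n and the term with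
  \<eta> contributes 1. A further contraction with conjugate \<eta> leaves -(n + 1) \<kappa> L equal
  to a smooth function, and L is positive.\<close>

lemma smooth_kappa: "smooth_on S \<kappa>c"
proof -
  define T where "T x = (\<Sum>h\<in>UNIV. cnj (\<eta> h x) * (\<Sum>k\<in>UNIV. \<delta>b h (N k k) x))" for x
  have "T x = - (\<kappa>c x * ((of_nat CARD('n) + 1) * Lc x))" if x: "x \<in> S" for x
  proof -
    have "(\<Sum>k\<in>UNIV. \<delta>b h (N k k) x) = - (\<kappa>c x * ((of_nat CARD('n) + 1) * Lb h x))" for h
      by (simp only: hdelbar_N[OF x] simp_thms if_True sum_negf sum_distrib_left[symmetric] sum.distrib euler_g[OF x])
        (simp add: algebra_simps)
    then have "T x = (\<Sum>h\<in>UNIV. - (\<kappa>c x * (of_nat CARD('n) + 1)) * (cnj (\<eta> h x) * Lb h x))"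
      unfolding T_def by (intro sum.cong refl) simp
    then have "T x = - (\<kappa>c x * (of_nat CARD('n) + 1)) * (\<Sum>h\<in>UNIV. cnj (\<eta> h x) * Lb h x)"
      by (simp only: sum_distrib_left)
    then show ?thesis by (simp add: euler_cnj[OF x])
  qed
  moreover have nz: "(of_nat CARD('n) + 1) * Lc x \<noteq> 0" if "x \<in> S" for x
    using L_pos[OF that] by (simp add: of_nat_Suc[symmetric] add.commute del: of_nat_Suc)
  ultimately have eq: "\<kappa>c x = - T x / ((of_nat CARD('n) + 1) * Lc x)" if "x \<in> S" for x
    using that nz[OF that] by (simp only: nonzero_eq_divide_eq minus_minus not_False_eq_True simp_thms)
  have "smooth_on S T"
    unfolding T_def[abs_def] by (intro smooth_intros smooth_eta \<delta>b.smooth smooth_N)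
  then have "smooth_on S (\<lambda>x. - T x / ((of_nat CARD('n) + 1) * Lc x))"
    by (intro smooth_on_divide[OF open_S nz] smooth_intros smooth_Lc)
  then show ?thesis
    using smooth_on_cong[OF open_S, of \<kappa>c "\<lambda>x. - T x / ((of_nat CARD('n) + 1) * Lc x)"] eq by simp
qed

text \<open>The barred derivative of \<open>conn_L\<close> is computed twice: from the curvature
  hypothesis, and by differentiating \<open>hdelbar_N\<close>, since \<open>conn_L\<close> is a
  fibre derivative of N. The right-hand side is the commutator left by the exchange of the two
  derivatives.\<close>

lemma deta_hdelbar_N:
  assumes x: "x \<in> S"
  shows "deta j \<kappa>c x * (\<eta> i x * g k h x + (if i = k then Lb h x else 0))
     + \<kappa>c x * \<eta> i x * deta j (g k h) x + \<kappa>c x * Lb h x * conn_C L i j k x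
   = (\<Sum>l\<in>UNIV. deta j (\<lambda>x. cnj (N l h x)) x * detabar l (N i k) x)" (is "_ = ?Q")
proof -
  let ?E = "\<lambda>x. \<eta> i x * g k h x + (if i = k then Lb h x else 0)"
  \<comment> \<open>The bracket of \<open>curvature_eq\<close>. It also arises from differentiating
    \<eta> and \<open>Lb\<close> in \<open>hdelbar_N\<close>, so it cancels in the
    comparison.\<close>
  define b where "b = (if i = j then g k h x else 0) + (if i = k then g j h x else 0)"
  have sm: "smooth_on S ?E"
    by (cases "i = k") (auto intro!: smooth_intros smooth_eta smooth_g smooth_Lb)
  have "deta j (\<delta>b h (N i k)) x = deta j (\<lambda>x. - (\<kappa>c x * ?E x)) x"
    by (rule deta.cong[OF x hdelbar_N])
  also have "\<dots> = - (deta j \<kappa>c x * ?E x + \<kappa>c x * deta j ?E x)"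
    using sm smooth_kappa x by (simp only: deta.minus deta.mult smooth_on_mult[OF open_S])
  also have "deta j ?E x = \<eta> i x * deta j (g k h) x + b"
    by (cases "i = k")
      (auto simp: deta.add deta.mult smooth_eta smooth_g smooth_Lb x smooth_intros fibre_coord_derivs fund_tensor_def[of _ j h] b_def)
  finally have 1: "deta j (\<delta>b h (N i k)) x = - (deta j \<kappa>c x * ?E x + \<kappa>c x * (\<eta> i x * deta j (g k h) x + b))" .
  have "\<delta>b h (conn_L L i j k) x = - (\<kappa>c x * b) - (\<Sum>l\<in>UNIV. \<delta>b h (N l k) x * conn_C L i j l x)"
    by (simp only: b_def curvature_eq[OF x, of i j h k, symmetric] curvature_def) simp
  also have "(\<Sum>l\<in>UNIV. \<delta>b h (N l k) x * conn_C L i j l x) =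
     - (\<kappa>c x * g k h x * (\<Sum>l\<in>UNIV. \<eta> l x * conn_C L i j l x)) - (\<Sum>l\<in>UNIV. if l = k then \<kappa>c x * Lb h x * conn_C L i j l x else 0)"
    unfolding sum_distrib_left sum_negf[symmetric] sum_subtractf[symmetric]
    by (intro sum.cong refl) (simp add: hdelbar_N[OF x] algebra_simps)
  also have "\<dots> = - (\<kappa>c x * Lb h x * conn_C L i j k x)"
    by (simp add: conn_C_eta[OF x])
  finally have 2: "\<delta>b h (conn_L L i j k) x = - (\<kappa>c x * b) + \<kappa>c x * Lb h x * conn_C L i j k x" by simp
  have "\<delta>b h (conn_L L i j k) x = \<delta>b h (deta j (N i k)) x"
    by (rule \<delta>b.cong[OF x conn_L_eq])
  moreover have "deta j (\<delta>b h (N i k)) x = \<delta>b h (deta j (N i k)) x - ?Q"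
    using wirtinger_hdelbar[OF smooth_N x] unfolding deta_wirtinger .
  ultimately show ?thesis using 1 2 by (simp add: algebra_simps)
qed

lemma lower_conn_C:
  assumes x: "x \<in> S"
  shows "(\<Sum>i\<in>UNIV. g i m x * conn_C L i j k x) = deta k (g j m) x"
  by (rule lower_index[OF x, where X = "\<lambda>i. conn_C L i j k x" and Y = "\<lambda>m. deta k (g j m) x"])
    (simp add: conn_C_def)

text \<open>Since \<open>deta i Lc\<close> is the metric contracted with conjugate \<eta>,
  \<open>lower_detabar_N\<close> applies. Conjugate \<eta> is annihilated by \<delta>, so the sum is
  a horizontal derivative of \<open>euler_detabar_Lb\<close>.\<close>

lemma detabar_N_contracted:
  assumes x: "x \<in> S"
  shows "(\<Sum>i\<in>UNIV. deta i Lc x * detabar l (N i k) x) = 0"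
proof -
  have "(\<Sum>i\<in>UNIV. deta i Lc x * detabar l (N i k) x) =
      (\<Sum>i\<in>UNIV. \<Sum>m\<in>UNIV. cnj (\<eta> m x) * (g i m x * detabar l (N i k) x))"
    by (simp add: euler_cnj_g[OF x, symmetric] sum_distrib_right mult.assoc)
  also have "\<dots> = (\<Sum>m\<in>UNIV. cnj (\<eta> m x) * (\<Sum>i\<in>UNIV. g i m x * detabar l (N i k) x))"
    unfolding sum_distrib_left by (rule sum.swap)
  also have "\<dots> = (\<Sum>m\<in>UNIV. cnj (\<eta> m x) * \<delta> k (detabar l (Lb m)) x)"
    by (simp only: lower_detabar_N[OF x])
  also have "\<dots> = \<delta> k (\<lambda>x. \<Sum>m\<in>UNIV. cnj (\<eta> m x) * detabar l (Lb m) x) x"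
    by (subst \<delta>.sum_mult[OF open_S])
      (auto simp: hdel_eta x intro!: smooth_intros smooth_eta smooth_Lb detabar.smooth)
  also have "\<dots> = 0"
    by (rule \<delta>.const_on[OF x, where c = 0]) (rule euler_detabar_Lb)
  finally show ?thesis .
qed

text \<open>Contraction of \<open>deta_hdelbar_N\<close> with \<open>deta i Lc\<close> gives the
  identity \<open>A\<close>, free of the commutator. Contracting \<open>A\<close> with \<eta>^k
  removes all terms with \<kappa> undifferentiated and isolates its derivative. Once this is zero,
  contraction with conjugate \<eta>^h isolates \<open>\<mu>\<close>, and \<open>A\<close> then
  yields the second claim.\<close>

lemma
  assumes x: "x \<in> S"
  shows deta_kappa: "deta j \<kappa>c x = 0"
    and kappa_deta_g: "\<kappa>c x * deta j (g k h) x = 0"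
proof -
  \<comment> \<open>The fibre derivative of the metric contracted with conjugate \<eta>; it is
    symmetric in its two indices.\<close>
  define \<mu> where "\<mu> k j = (\<Sum>m\<in>UNIV. cnj (\<eta> m x) * deta j (g k m) x)" for k j
  have \<mu>_sym: "\<mu> k j = \<mu> j k" for k j by (simp add: \<mu>_def deta_g_sym[OF x, of j])
  have L0: "Lc x \<noteq> 0" using L_pos[OF x] by simp
  have \<mu>_C: "(\<Sum>i\<in>UNIV. deta i Lc x * conn_C L i j k x) = \<mu> j k" for k j
  proof -
    have "(\<Sum>i\<in>UNIV. deta i Lc x * conn_C L i j k x) =
        (\<Sum>i\<in>UNIV. \<Sum>m\<in>UNIV. cnj (\<eta> m x) * (g i m x * conn_C L i j k x))"
      by (simp add: euler_cnj_g[OF x, symmetric] sum_distrib_right mult.assoc)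
    also have "\<dots> = (\<Sum>m\<in>UNIV. cnj (\<eta> m x) * (\<Sum>i\<in>UNIV. g i m x * conn_C L i j k x))"
      unfolding sum_distrib_left by (rule sum.swap)
    finally show ?thesis by (simp only: lower_conn_C[OF x] \<mu>_def)
  qed
  have \<mu>_eta: "(\<Sum>k\<in>UNIV. \<eta> k x * \<mu> j k) = 0" for j
  proof -
    have "(\<Sum>k\<in>UNIV. \<eta> k x * \<mu> j k) = (\<Sum>m\<in>UNIV. cnj (\<eta> m x) * (\<Sum>k\<in>UNIV. \<eta> k x * deta j (g k m) x))"
      by (simp add: \<mu>_def sum_distrib_left deta_g_sym[OF x, of _ j] mult.left_commute) (rule sum.swap)
    then show ?thesis by (simp add: euler_deta_g[OF x])
  qed
  have A: "deta j \<kappa>c x * (Lc x * g k h x + deta k Lc x * Lb h x) + \<kappa>c x * Lc x * deta j (g k h) x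
      + \<kappa>c x * Lb h x * \<mu> j k = 0" for j k h
  proof -
    let ?T = "\<lambda>i. deta j \<kappa>c x * (\<eta> i x * g k h x + (if i = k then Lb h x else 0))
       + \<kappa>c x * \<eta> i x * deta j (g k h) x + \<kappa>c x * Lb h x * conn_C L i j k x"
    have "(\<Sum>i\<in>UNIV. deta i Lc x * ?T i) =
       (\<Sum>i\<in>UNIV. \<Sum>l\<in>UNIV. deta j (\<lambda>x. cnj (N l h x)) x * (deta i Lc x * detabar l (N i k) x))"
      by (simp add: deta_hdelbar_N[OF x] sum_distrib_left mult.left_commute)
    also have "\<dots> = (\<Sum>l\<in>UNIV. deta j (\<lambda>x. cnj (N l h x)) x * (\<Sum>i\<in>UNIV. deta i Lc x * detabar l (N i k) x))"
      unfolding sum_distrib_left by (rule sum.swap)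
    also have "\<dots> = 0" by (simp add: detabar_N_contracted[OF x])
    finally have "0 = (\<Sum>i\<in>UNIV. deta i Lc x * ?T i)" by simp
    also have "\<dots> = (deta j \<kappa>c x * g k h x + \<kappa>c x * deta j (g k h) x) * (\<Sum>i\<in>UNIV. \<eta> i x * deta i Lc x)
       + (\<Sum>i\<in>UNIV. if i = k then deta j \<kappa>c x * deta i Lc x * Lb h x else 0)
       + \<kappa>c x * Lb h x * (\<Sum>i\<in>UNIV. deta i Lc x * conn_C L i j k x)"
      unfolding sum_distrib_left sum.distrib[symmetric]
      by (intro sum.cong refl) (simp add: algebra_simps)
    also have "\<dots> = (deta j \<kappa>c x * g k h x + \<kappa>c x * deta j (g k h) x) * Lc x
       + deta j \<kappa>c x * deta k Lc x * Lb h x + \<kappa>c x * Lb h x * \<mu> j k"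
      by (simp add: euler[OF x] \<mu>_C)
    finally show ?thesis by (simp add: algebra_simps)
  qed
  have "deta j \<kappa>c x * (2 * Lc x * Lb h x) = 0" for j h
  proof -
    have "0 = (\<Sum>k\<in>UNIV. \<eta> k x * (deta j \<kappa>c x * (Lc x * g k h x + deta k Lc x * Lb h x) + \<kappa>c x * Lc x * deta j (g k h) x
      + \<kappa>c x * Lb h x * \<mu> j k))" by (simp only: A) simp
    also have "\<dots> = deta j \<kappa>c x * Lc x * (\<Sum>k\<in>UNIV. \<eta> k x * g k h x) + deta j \<kappa>c x * Lb h x * (\<Sum>k\<in>UNIV. \<eta> k x * deta k Lc x)
       + \<kappa>c x * Lc x * (\<Sum>k\<in>UNIV. \<eta> k x * deta j (g k h) x) + \<kappa>c x * Lb h x * (\<Sum>k\<in>UNIV. \<eta> k x * \<mu> j k)"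
      unfolding sum_distrib_left sum.distrib[symmetric]
      by (intro sum.cong refl) (simp add: algebra_simps)
    also have "\<dots> = deta j \<kappa>c x * (2 * Lc x * Lb h x)"
      by (simp add: euler[OF x] euler_g[OF x] \<mu>_eta euler_deta_g[OF x])
    finally show ?thesis by simp
  qed
  then have "(\<Sum>h\<in>UNIV. cnj (\<eta> h x) * (deta j \<kappa>c x * (2 * Lc x * Lb h x))) = 0" for j
    by (simp only: mult_zero_right sum.neutral_const)
  moreover have "(\<Sum>h\<in>UNIV. cnj (\<eta> h x) * (deta j \<kappa>c x * (2 * Lc x * Lb h x))) =
      deta j \<kappa>c x * 2 * Lc x * (\<Sum>h\<in>UNIV. cnj (\<eta> h x) * Lb h x)" for j
    unfolding sum_distrib_left by (intro sum.cong refl) simp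
  ultimately show K0: "deta j \<kappa>c x = 0" for j using L0 by (simp add: euler_cnj[OF x])
  have B: "\<kappa>c x * Lc x * deta j (g k h) x + \<kappa>c x * Lb h x * \<mu> j k = 0" for j k h
    using A[of j k h] by (simp add: K0)
  \<comment> \<open>Symmetry of \<open>\<mu>\<close> makes the two contracted terms add up to 2 L
    \<kappa> \<open>\<mu>\<close> instead of cancelling.\<close>
  have "\<kappa>c x * \<mu> j k = 0" for j k
  proof -
    have "0 = (\<Sum>h\<in>UNIV. cnj (\<eta> h x) * (\<kappa>c x * Lc x * deta j (g k h) x + \<kappa>c x * Lb h x * \<mu> j k))"
      by (simp only: B) simp
    also have "\<dots> = \<kappa>c x * Lc x * \<mu> k j + \<kappa>c x * \<mu> j k * (\<Sum>h\<in>UNIV. cnj (\<eta> h x) * Lb h x)"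
      unfolding \<mu>_def[of k j] sum_distrib_left sum.distrib[symmetric]
      by (intro sum.cong refl) (simp add: algebra_simps)
    also have "\<dots> = 2 * Lc x * (\<kappa>c x * \<mu> j k)"
      by (simp add: euler_cnj[OF x] \<mu>_sym[of k j])
    finally show ?thesis using L0 by simp
  qed
  from this[of j k] have "\<kappa>c x * Lb h x * \<mu> j k = 0" by auto
  with B[of j k h] have "\<kappa>c x * Lc x * deta j (g k h) x = 0" by (simp only: add_0_right)
  then show "\<kappa>c x * deta j (g k h) x = 0" using L0 by simp
qed

text \<open>\<kappa> is real, so its antiholomorphic derivative is the conjugate of the holomorphic
  one.\<close>

lemma detabar_kappa: "x \<in> S \<Longrightarrow> detabar j \<kappa>c x = 0"
  using detabar_cnj[OF smooth_on_differentiable[OF smooth_kappa], of x j] deta_kappa by simp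

lemma kappa_constant_on_fibre:
  "z \<in> U \<Longrightarrow> v \<noteq> 0 \<Longrightarrow> v' \<noteq> 0 \<Longrightarrow> \<kappa> (z, v) = \<kappa> (z, v')"
  using constant_on_fibre[OF smooth_kappa, of z v v'] deta_kappa detabar_kappa by (simp add: S_def)

lemma g_constant_on_fibre:
  assumes z: "z \<in> U" "v \<noteq> 0" "v' \<noteq> 0" and "\<kappa> (z, v) \<noteq> 0"
  shows "g i j (z, v) = g i j (z, v')"
proof (rule constant_on_fibre[OF smooth_g z])
  fix w :: "complex^'n" and k assume w: "w \<noteq> 0"
  then have x: "(z, w) \<in> S" using z by (simp add: S_def)
  have "\<kappa> (z, w) \<noteq> 0" using kappa_constant_on_fibre[of z v w] assms w by simp
  then have 1: "deta k (g i j) (z, w) = 0" for i j using kappa_deta_g[OF x] by simp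
  \<comment> \<open>\<open>kappa_deta_g\<close> covers only holomorphic fibre derivatives; Hermitian
    symmetry of the metric supplies the antiholomorphic ones.\<close>
  have "detabar k (g i j) (z, w) = detabar k (\<lambda>x. cnj (g j i x)) (z, w)"
    by (rule detabar.cong[OF x]) (simp add: g_hermitian)
  also have "\<dots> = 0" by (simp add: detabar_cnj[OF smooth_on_differentiable[OF smooth_g x]] 1)
  finally show "deta k (g i j) (z, w) = 0 \<and> detabar k (g i j) (z, w) = 0" using 1 by simp
qed

text \<open>On \<open>S\<close> this is the conjugate of the sum over h of
  \<open>conn_L L h l h x - conn_L L h h l x\<close>, the trace of the torsion of the horizontal
  connection. It need not vanish, since the metric is not assumed Kaehler.\<close>

definition torsion_trace :: "'n \<Rightarrow> 'n coords \<Rightarrow> complex" where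
  "torsion_trace l x = (\<Sum>h\<in>UNIV. \<Sum>k\<in>UNIV. gi h k x * (\<delta>b h (g k l) x - \<delta>b l (g k h) x))"

text \<open>Obtained from the symmetry of \<open>\<delta>b l (\<delta>b h (N i k))\<close> in \<open>l\<close> and \<open>h\<close>, by taking traces.\<close>
lemma dzbar_kappa:
  assumes x: "x \<in> S"
  shows "(of_nat CARD('n) - 1) * dzbar l \<kappa>c x = \<kappa>c x * torsion_trace l x"
proof -
  \<comment> \<open>\<open>X\<close> and \<open>Y\<close> are the values of the barred \<delta> on
    \<kappa> g and on \<kappa> \<open>Lb\<close>. They contain \<open>dzbar\<close> of \<kappa>
    because \<kappa> has no fibre derivative.\<close>
  define X where "X k l h = dzbar l \<kappa>c x * g k h x + \<kappa>c x * \<delta>b l (g k h) x" for k l h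
  define Y where "Y l h = dzbar l \<kappa>c x * Lb h x + \<kappa>c x * \<delta>b l (Lb h) x" for l h
  have \<delta>\<kappa>: "\<delta>b l \<kappa>c x = dzbar l \<kappa>c x" for l
    by (simp add: hdelbar_def detabar_kappa[OF x])
  have \<delta>\<delta>N: "\<delta>b l (\<delta>b h (N i k)) x = - (\<eta> i x * X k l h + (if i = k then Y l h else 0))" for l h i k
  proof -
    let ?E = "\<lambda>x. \<eta> i x * g k h x + (if i = k then Lb h x else 0)"
    have sm: "smooth_on S ?E"
      by (cases "i = k") (auto intro!: smooth_intros smooth_eta smooth_g smooth_Lb)
    have "\<delta>b l (\<delta>b h (N i k)) x = \<delta>b l (\<lambda>x. - (\<kappa>c x * ?E x)) x"
      by (rule \<delta>b.cong[OF x hdelbar_N])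
    also have "\<dots> = - (\<delta>b l \<kappa>c x * ?E x + \<kappa>c x * \<delta>b l ?E x)"
      using sm smooth_kappa x by (simp only: \<delta>b.minus \<delta>b.mult smooth_on_mult[OF open_S])
    also have "\<delta>b l ?E x = \<eta> i x * \<delta>b l (g k h) x + (if i = k then \<delta>b l (Lb h) x else 0)"
      by (cases "i = k")
        (auto simp: \<delta>b.add \<delta>b.mult smooth_eta smooth_g smooth_Lb x smooth_intros hdel_eta)
    also have "- (\<delta>b l \<kappa>c x * ?E x + \<kappa>c x * (\<eta> i x * \<delta>b l (g k h) x + (if i = k then \<delta>b l (Lb h) x else 0)))
        = - (\<eta> i x * X k l h + (if i = k then Y l h else 0))"
      by (simp add: \<delta>\<kappa> X_def Y_def algebra_simps)
    finally show ?thesis .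
  qed
  have eq: "\<eta> i x * (X k l h - X k h l) + (if i = k then Y l h - Y h l else 0) = 0" for i k l h
    using hdelbar_commute[OF smooth_N x, of l h i k] by (auto simp: \<delta>\<delta>N algebra_simps split: if_splits)
  have XY: "(\<Sum>k\<in>UNIV. \<eta> k x * X k l h) = Y l h" for l h
  proof -
    have "(\<Sum>k\<in>UNIV. \<eta> k x * X k l h) = dzbar l \<kappa>c x * (\<Sum>k\<in>UNIV. \<eta> k x * g k h x) + \<kappa>c x * (\<Sum>k\<in>UNIV. \<eta> k x * \<delta>b l (g k h) x)"
      by (simp add: X_def sum_distrib_left sum.distrib algebra_simps)
    also have "(\<Sum>k\<in>UNIV. \<eta> k x * \<delta>b l (g k h) x) = \<delta>b l (\<lambda>x. \<Sum>k\<in>UNIV. \<eta> k x * g k h x) x"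
      by (subst \<delta>b.sum_mult[OF open_S]) (auto simp: hdel_eta x smooth_eta smooth_g)
    also have "\<dots> = \<delta>b l (Lb h) x"
      by (rule \<delta>b.cong[OF x euler_g])
    finally show ?thesis by (simp add: Y_def euler_g[OF x])
  qed
  \<comment> \<open>The trace of \<open>eq\<close> over i = k. By \<open>XY\<close> the first part
    contributes one copy of the antisymmetric part of \<open>Y\<close> and the Kronecker part n
    copies, and n + 1 is nonzero.\<close>
  have Y_sym: "Y l h = Y h l" for l h
  proof -
    have "0 = (\<Sum>k\<in>UNIV. \<eta> k x * (X k l h - X k h l) + (if k = k then Y l h - Y h l else 0))"
      by (simp only: eq) simp
    also have "\<dots> = (of_nat CARD('n) + 1) * (Y l h - Y h l)"
      by (simp add: sum.distrib sum_subtractf right_diff_distrib XY algebra_simps)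
    finally show ?thesis
      by (simp add: of_nat_Suc[symmetric] add.commute del: of_nat_Suc)
  qed
  \<comment> \<open>With \<open>Y\<close> symmetric, \<open>eq\<close> says that \<eta>^i times the
    antisymmetric part of \<open>X\<close> is zero; off the zero section some \<eta>^i can be
    cancelled.\<close>
  have X_sym: "X k l h = X k h l" for k l h
  proof -
    have "snd x \<noteq> 0" using x by (auto simp: S_def)
    then obtain i where "\<eta> i x \<noteq> 0" using vec_eq_iff[of "snd x" 0] by auto
    then show ?thesis using eq[of i k l h] Y_sym[of l h] by (simp split: if_splits)
  qed
  have gi_swap: "(\<Sum>k\<in>UNIV. gi h k x * g k l x) = (if h = l then 1 else 0)" for h l
    by (rule g_inverse(2)[OF x])
  \<comment> \<open>Both sides of \<open>X_sym\<close> are traced with the inverse metric. The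
    derivative of \<kappa> appears n times on one side, and only once on the other, where its index
    is part of the trace.\<close>
  define P where "P = (\<Sum>h\<in>UNIV. \<Sum>k\<in>UNIV. gi h k x * \<delta>b l (g k h) x)"
  define Q where "Q = (\<Sum>h\<in>UNIV. \<Sum>k\<in>UNIV. gi h k x * \<delta>b h (g k l) x)"
  have "(\<Sum>h\<in>UNIV. \<Sum>k\<in>UNIV. gi h k x * X k l h) = (\<Sum>h\<in>UNIV. \<Sum>k\<in>UNIV. gi h k x * X k h l)"
    by (simp only: X_sym[of _ l])
  moreover have "(\<Sum>h\<in>UNIV. \<Sum>k\<in>UNIV. gi h k x * X k l h) =
     of_nat CARD('n) * dzbar l \<kappa>c x + \<kappa>c x * P"
  proof -
    have "(\<Sum>k\<in>UNIV. gi h k x * X k l h) = dzbar l \<kappa>c x * (\<Sum>k\<in>UNIV. gi h k x * g k h x)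
       + \<kappa>c x * (\<Sum>k\<in>UNIV. gi h k x * \<delta>b l (g k h) x)" for h
      by (simp add: X_def sum_distrib_left sum.distrib algebra_simps)
    then show ?thesis by (simp add: P_def gi_swap sum.distrib sum_distrib_left)
  qed
  moreover have "(\<Sum>h\<in>UNIV. \<Sum>k\<in>UNIV. gi h k x * X k h l) =
     dzbar l \<kappa>c x + \<kappa>c x * Q"
  proof -
    have "(\<Sum>k\<in>UNIV. gi h k x * X k h l) = dzbar h \<kappa>c x * (\<Sum>k\<in>UNIV. gi h k x * g k l x)
       + \<kappa>c x * (\<Sum>k\<in>UNIV. gi h k x * \<delta>b h (g k l) x)" for h
      by (simp add: X_def sum_distrib_left sum.distrib algebra_simps)
    then show ?thesis
      by (simp add: Q_def gi_swap sum.distrib sum_distrib_left if_distrib[of "\<lambda>t. _ * t"] cong: if_cong)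
  qed
  ultimately have "of_nat CARD('n) * dzbar l \<kappa>c x + \<kappa>c x * P = dzbar l \<kappa>c x + \<kappa>c x * Q"
    by simp
  moreover have "torsion_trace l x = Q - P"
    by (simp add: torsion_trace_def P_def Q_def right_diff_distrib sum_subtractf)
  ultimately show ?thesis by algebra
qed

section \<open>Openness of the zero set of \<kappa>\<close>

lemma smooth_torsion_trace: "smooth_on S (torsion_trace l)"
  unfolding torsion_trace_def[abs_def] by (intro smooth_intros smooth_gi \<delta>b.smooth smooth_g)

text \<open>By \<open>dzbar_kappa\<close>, \<open>\<kappa>\<close> satisfies a homogeneous linear differential inequality along segments in
  the base, to which Gronwall's argument applies.\<close>
lemma kappa_zero_open:
  assumes n: "CARD('n) \<ge> 2" and z: "z \<in> U" and v: "v \<noteq> 0" and 0: "\<kappa> (z, v) = 0"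
  obtains r where "r > 0" "ball z r \<subseteq> U" "\<And>w. w \<in> ball z r \<Longrightarrow> \<kappa> (w, v) = 0"
proof -
  \<comment> \<open>The factor 2 accounts for \<open>dz\<close> and \<open>dzbar\<close> of
    \<kappa>, which have equal modulus because \<kappa> is real.\<close>
  define B where "B x = (\<Sum>k\<in>UNIV. 2 * cmod (torsion_trace k x))" for x
  have S: "(w, v) \<in> S" if "w \<in> U" for w using that v by (simp add: S_def)
  have der: "((\<lambda>w. \<kappa> (w, v)) has_derivative (\<lambda>\<zeta>. Re (dir_deriv (\<zeta>, 0) \<kappa>c (w, v)))) (at w)" if "w \<in> U" for w
  proof -
    have "((\<lambda>w. (w, v)) has_derivative (\<lambda>u. (u, 0))) (at w)"
      by (auto intro!: derivative_eq_intros)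
    from bounded_linear.has_derivative[OF bounded_linear_Re has_derivative_compose[OF this smooth_on_has_derivative[OF smooth_kappa S[OF that]]]]
    show ?thesis by simp
  qed
  have bound: "\<bar>Re (dir_deriv (\<zeta>, 0) \<kappa>c (w, v))\<bar> \<le> B (w, v) * norm \<zeta> * \<bar>\<kappa> (w, v)\<bar>" if w: "w \<in> U" for w \<zeta>
  proof -
    let ?x = "(w, v)"
    note diff = smooth_on_differentiable[OF smooth_kappa S[OF w]]
    have 1: "cmod (dzbar k \<kappa>c ?x) \<le> \<bar>\<kappa> ?x\<bar> * cmod (torsion_trace k ?x)" for k
    proof -
      have "cmod (dzbar k \<kappa>c ?x) \<le> (real CARD('n) - 1) * cmod (dzbar k \<kappa>c ?x)"
        \<comment> \<open>Here n at least 2 is used: the factor n - 1 is at least 1 and may be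
          inserted.\<close>
        using n mult_right_mono[of 1 "real CARD('n) - 1" "cmod (dzbar k \<kappa>c ?x)"] by simp
      also have "\<dots> = cmod ((of_nat CARD('n) - 1) * dzbar k \<kappa>c ?x)"
      proof -
        have "of_nat CARD('n) - 1 = complex_of_real (real CARD('n) - 1)" by simp
        then have "cmod (of_nat CARD('n) - 1) = real CARD('n) - 1"
          using n by (simp only: norm_of_real)
        then show ?thesis by (simp only: norm_mult)
      qed
      also have "\<dots> = \<bar>\<kappa> ?x\<bar> * cmod (torsion_trace k ?x)"
        by (simp add: dzbar_kappa[OF S[OF w]] norm_mult)
      finally show ?thesis .
    qed
    have 2: "dz k \<kappa>c ?x = cnj (dzbar k \<kappa>c ?x)" for k
      using dz_cnj[OF diff, of k] by simp
    have "\<bar>Re (dir_deriv (\<zeta>, 0) \<kappa>c ?x)\<bar> \<le> cmod (dir_deriv (\<zeta>, 0) \<kappa>c ?x)"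
      by (rule abs_Re_le_cmod)
    also have "\<dots> \<le> (\<Sum>k\<in>UNIV. cmod (\<zeta> $ k * dz k \<kappa>c ?x + cnj (\<zeta> $ k) * dzbar k \<kappa>c ?x))"
      unfolding dir_deriv_base[OF diff] by (rule norm_sum)
    also have "\<dots> \<le> (\<Sum>k\<in>UNIV. (2 * cmod (torsion_trace k ?x)) * (norm \<zeta> * \<bar>\<kappa> ?x\<bar>))"
    proof (rule sum_mono)
      fix k
      have "cmod (\<zeta> $ k * dz k \<kappa>c ?x + cnj (\<zeta> $ k) * dzbar k \<kappa>c ?x) \<le> 2 * (cmod (\<zeta> $ k) * cmod (dzbar k \<kappa>c ?x))"
        using norm_triangle_ineq[of "\<zeta> $ k * dz k \<kappa>c ?x" "cnj (\<zeta> $ k) * dzbar k \<kappa>c ?x"]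
        by (simp add: norm_mult 2)
      also have "\<dots> \<le> 2 * (norm \<zeta> * (\<bar>\<kappa> ?x\<bar> * cmod (torsion_trace k ?x)))"
        using Finite_Cartesian_Product.norm_nth_le[of \<zeta> k] 1[of k] by (intro mult_left_mono mult_mono) auto
      finally show "cmod (\<zeta> $ k * dz k \<kappa>c ?x + cnj (\<zeta> $ k) * dzbar k \<kappa>c ?x)
          \<le> (2 * cmod (torsion_trace k ?x)) * (norm \<zeta> * \<bar>\<kappa> ?x\<bar>)"
        by (simp add: mult_ac)
    qed
    also have "\<dots> = B ?x * norm \<zeta> * \<bar>\<kappa> ?x\<bar>"
      by (simp only: B_def sum_distrib_right mult.assoc)
    finally show ?thesis .
  qed
  \<comment> \<open>A closed ball is taken so that compactness bounds \<open>B\<close> by a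
    constant.\<close>
  have "\<exists>r>0. cball z r \<subseteq> U"
    using z open_base by (simp only: open_contains_cball)
  then obtain r where r: "r > 0" "cball z r \<subseteq> U" by blast
  have "continuous_on S B"
    unfolding B_def[abs_def]
    by (intro continuous_intros smooth_on_imp_continuous_on smooth_torsion_trace)
  then have "continuous_on (cball z r) (\<lambda>w. B (w, v))"
    using S r(2) by (intro continuous_on_compose2[of S B _ "\<lambda>w. (w, v)"]) (auto intro!: continuous_intros)
  then have "bounded ((\<lambda>w. B (w, v)) ` cball z r)"
    by (intro compact_imp_bounded compact_continuous_image) auto
  then obtain M where M: "M > 0" "\<And>w. w \<in> cball z r \<Longrightarrow> B (w, v) \<le> M"
    unfolding bounded_pos by (auto, metis abs_le_D1 mem_cball)
  show thesis
  proof (rule that[of r])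
    show "r > 0" by (rule r)
    show "ball z r \<subseteq> U" using r(2) ball_subset_cball by blast
    fix w assume w: "w \<in> ball z r"
    define u where "u t = \<kappa> (z + t *\<^sub>R (w - z), v)" for t :: real
    define u' where "u' t = Re (dir_deriv (w - z, 0) \<kappa>c (z + t *\<^sub>R (w - z), v))" for t :: real
    define C where "C = M * norm (w - z)"
    have seg: "z + t *\<^sub>R (w - z) \<in> cball z r" if "0 \<le> t" "t \<le> 1" for t
    proof -
      have "norm (t *\<^sub>R (w - z)) \<le> 1 * norm (w - z)"
        using that mult_right_mono[of t 1 "norm (w - z)"] by simp
      also have "\<dots> \<le> r" using w by (simp add: dist_norm norm_minus_commute)
      finally show ?thesis by (simp add: dist_norm)
    qed
    have du: "(u has_real_derivative u' t) (at t)" if "0 \<le> t" "t \<le> 1" for t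
    proof -
      have U: "z + t *\<^sub>R (w - z) \<in> U" using seg[OF that] r(2) by blast
      have "((\<lambda>t. z + t *\<^sub>R (w - z)) has_derivative (\<lambda>s. s *\<^sub>R (w - z))) (at t)"
        by (auto intro!: derivative_eq_intros)
      from has_derivative_compose[OF this der[OF U]]
      have "(u has_derivative (\<lambda>s. Re (dir_deriv (s *\<^sub>R (w - z, 0)) \<kappa>c (z + t *\<^sub>R (w - z), v)))) (at t)"
        by (simp add: u_def[abs_def])
      then show ?thesis
        unfolding has_field_derivative_def u'_def
        using linear_scale[OF linear_frechet_derivative[OF smooth_on_differentiable[OF smooth_kappa S[OF U]]], of _ "(w - z, 0)"]
        by (simp only:) (simp add: mult_commute_abs)
    qed
    have bu: "\<bar>u' t\<bar> \<le> C * \<bar>u t\<bar>" if "0 \<le> t" "t \<le> 1" for t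
    proof -
      have "z + t *\<^sub>R (w - z) \<in> U" using seg[OF that] r(2) by blast
      from bound[OF this, of "w - z"]
      have "\<bar>u' t\<bar> \<le> B (z + t *\<^sub>R (w - z), v) * norm (w - z) * \<bar>u t\<bar>"
        by (simp add: u'_def u_def)
      also have "\<dots> \<le> M * norm (w - z) * \<bar>u t\<bar>"
        using M(2)[OF seg[OF that]] by (intro mult_right_mono) auto
      finally show ?thesis by (simp add: C_def)
    qed
    \<comment> \<open>The square avoids differentiating an absolute value. Its derivative is at most
      2 C times itself, so the exponential weight makes the product nonincreasing, and it starts at
      0.\<close>
    have "(u 1)\<^sup>2 * exp (- 2 * C * 1) \<le> (u 0)\<^sup>2 * exp (- 2 * C * 0)"
    proof (rule DERIV_nonpos_imp_nonincreasing[where f = "\<lambda>t. (u t)\<^sup>2 * exp (- 2 * C * t)"])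
      fix t :: real assume t: "0 \<le> t" "t \<le> 1"
      have "((\<lambda>t. (u t)\<^sup>2 * exp (- 2 * C * t)) has_real_derivative
          2 * (u t * u' t - C * (u t)\<^sup>2) * exp (- 2 * C * t)) (at t)"
        by (rule derivative_eq_intros du[OF t] refl)+ (simp add: algebra_simps power2_eq_square)
      moreover have "u t * u' t \<le> C * (u t)\<^sup>2"
      proof -
        have "u t * u' t \<le> \<bar>u t\<bar> * \<bar>u' t\<bar>" by (metis abs_ge_self abs_mult)
        also have "\<dots> \<le> \<bar>u t\<bar> * (C * \<bar>u t\<bar>)" by (intro mult_left_mono bu t) simp
        also have "\<dots> = C * (u t)\<^sup>2" by (simp add: power2_eq_square)
        finally show ?thesis .
      qed
      ultimately show "\<exists>y. ((\<lambda>t. (u t)\<^sup>2 * exp (- 2 * C * t)) has_real_derivative y) (at t) \<and> y \<le> 0"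
        by (intro exI conjI) (auto simp: mult_nonpos_nonneg)
    qed simp
    then have "(u 1)\<^sup>2 * exp (- 2 * C * 1) \<le> 0" using 0 by (simp add: u_def)
    then have "(u 1)\<^sup>2 \<le> 0" by (simp add: mult_le_0_iff)
    then show "\<kappa> (w, v) = 0" by (simp add: u_def)
  qed
qed

end

end


section \<open>From charts to the manifold\<close>

context complex_manifold begin

lemma openin_chart_preimage:
  assumes c: "c \<in> A" and W: "open W"
  shows "openin X {q \<in> fst c. snd c q \<in> W}"
proof -
  have sub: "fst c \<subseteq> topspace X" by (rule openin_subset[OF chart_domain_open[OF c]])
  have "continuous_map (subtopology X (fst c)) (top_of_set (chart_image c)) (snd c)"
    by (rule homeomorphic_imp_continuous_map[OF chart_homeomorphic[OF c]])
  moreover have "openin (top_of_set (chart_image c)) (chart_image c \<inter> W)"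
    using W by (simp add: openin_open_Int)
  ultimately have "openin (subtopology X (fst c)) {q \<in> topspace (subtopology X (fst c)). snd c q \<in> chart_image c \<inter> W}"
    by (rule openin_continuous_map_preimage)
  moreover have "{q \<in> topspace (subtopology X (fst c)). snd c q \<in> chart_image c \<inter> W} = {q \<in> fst c. snd c q \<in> W}"
    using sub by (auto simp: chart_image_def)
  ultimately show ?thesis
    using openin_trans_full[OF _ chart_domain_open[OF c]] by metis
qed

text \<open>Holomorphic transition maps have complex-linear differentials, so scaling in one chart
  scales the components in every chart. This transfers the homogeneity of F to coordinates.\<close>

lemma tangent_point_scale:
  assumes c: "c \<in> A" and z: "z \<in> chart_image c"
  shows "tangent_point A c (z, a *s \<eta>) =
    (fst (tangent_point A c (z, \<eta>)), tvec_scale a (snd (tangent_point A c (z, \<eta>))))"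
proof -
  obtain p where p: "p \<in> fst c" "z = snd c p" using z by (auto simp: chart_image_def)
  have "frechet_derivative (transition c d) (at z) (a *s \<eta>) = a *s frechet_derivative (transition c d) (at z) \<eta>"
    if d: "d \<in> charts_at A p" for d
  proof -
    have "z \<in> snd c ` (fst c \<inter> fst d)" using d p by (auto simp: charts_at_def)
    then obtain D where D: "(transition c d has_derivative D) (at z)" "\<And>a v. D (a *s v) = a *s D v"
      using transition_holomorphic[OF c, of d] d
      unfolding holomorphic_map_on_def charts_at_def by blast
    from frechet_derivative_at[OF D(1)] D(2) show ?thesis by metis
  qed
  then show ?thesis
    using c p by (auto simp: tangent_point_def tvec_scale_def chart_inv_chart fun_eq_iff)
qed

lemma tangent_point_slit:
  assumes c: "c \<in> A" and p: "p \<in> fst c" and \<eta>: "\<eta> \<noteq> 0"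
  shows "tangent_point A c (snd c p, \<eta>) \<in> slit_tangent_bundle X A"
    and "fst (tangent_point A c (snd c p, \<eta>)) = p"
proof -
  have cp: "c \<in> charts_at A p" using c p by (simp add: charts_at_def)
  show fst: "fst (tangent_point A c (snd c p, \<eta>)) = p"
    by (simp add: tangent_point_def chart_inv_chart c p)
  have "snd (tangent_point A c (snd c p, \<eta>)) c = \<eta>"
    using cp transition_self[OF cp] by (simp add: tangent_point_def chart_inv_chart c p)
  then have "snd (tangent_point A c (snd c p, \<eta>)) \<noteq> tvec_zero"
    using \<eta> by (auto simp: tvec_zero_def)
  moreover have "tangent_point A c (snd c p, \<eta>) \<in> hol_tangent_bundle X A"
    using bij_betw_apply[OF bij_betw_tangent_point[OF c], of "(snd c p, \<eta>)"] p
    by (auto simp: chart_image_def)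
  ultimately show "tangent_point A c (snd c p, \<eta>) \<in> slit_tangent_bundle X A"
    by (auto simp: slit_tangent_bundle_def)
qed

lemma slit_tangent_bundle_cases:
  assumes c: "c \<in> A" and p: "p \<in> fst c" and v: "(p, v) \<in> slit_tangent_bundle X A"
  obtains \<eta> where "\<eta> \<noteq> 0" "tangent_point A c (snd c p, \<eta>) = (p, v)"
proof -
  have "(p, v) \<in> tangent_point A c ` (chart_image c \<times> UNIV)"
    using v p bij_betw_imp_surj_on[OF bij_betw_tangent_point[OF c]] by (auto simp: slit_tangent_bundle_def)
  then obtain z \<eta> where z: "z \<in> chart_image c" and eq: "tangent_point A c (z, \<eta>) = (p, v)" by auto
  obtain q where q: "q \<in> fst c" "z = snd c q" using z by (auto simp: chart_image_def)
  then have "q = p" using eq by (simp add: tangent_point_def chart_inv_chart c)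
  \<comment> \<open>A zero coordinate vector is 0 times itself, so scaling by 0 would fix the
    tangent vector and force it to be \<open>tvec_zero\<close>.\<close>
  moreover have "\<eta> \<noteq> 0"
  proof
    assume "\<eta> = 0"
    then have "(p, v) = (fst (p, v), tvec_scale 0 (snd (p, v)))"
      using tangent_point_scale[OF c z, of 0 \<eta>] eq by simp
    then show False using v by (simp add: slit_tangent_bundle_def tvec_scale_def tvec_zero_def)
  qed
  ultimately show thesis using that eq q by blast
qed

end

section \<open>The coordinate results in every chart, and the global dichotomy\<close>

lemma (in complex_finsler_space) finsler_chart:
  assumes c: "c \<in> A"
  shows "finsler_chart (chart_image c) (local_L A F c)"
proof
  show "open (chart_image c)" by (rule chart_image_open[OF c])
  show "smooth_on (chart_image c \<times> (UNIV - {0})) (local_L A F c)"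
    using L_smooth[OF c] by (simp add: slit_coords_def)
  show "hermitian_pos_def (\<chi> i j. fund_tensor (local_L A F c) i j x)"
    if "x \<in> chart_image c \<times> (UNIV - {0})" for x
    using fund_tensor_pos_def[OF c] that by (simp add: slit_coords_def)
  show "local_L A F c (z, a *s \<eta>) = (cmod a)\<^sup>2 * local_L A F c (z, \<eta>)"
    if z: "(z, \<eta>) \<in> chart_image c \<times> (UNIV - {0})" for z \<eta> a
  proof -
    have "tangent_point A c (z, \<eta>) \<in> hol_tangent_bundle X A"
      using bij_betw_apply[OF bij_betw_tangent_point[OF c], of "(z, \<eta>)"] z by auto
    then show ?thesis
      using z F_homogeneous[of "fst (tangent_point A c (z, \<eta>))" "snd (tangent_point A c (z, \<eta>))" a]
      by (simp add: local_L_def tangent_point_scale[OF c] power_mult_distrib)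
  qed
qed

text \<open>The bound on the dimension enters through the factor n - 1 in
  \<open>dzbar_kappa\<close>, and connectedness through the clopen zero set of the base
  function.\<close>

theorem (in complex_finsler_space) constant_curvature_dichotomy:
  fixes K :: "'a \<times> ('a, 'n) tvec \<Rightarrow> real"
  assumes n: "CARD('n) \<ge> 2" and connected: "connected_space X"
    and curv: "\<And>c x r j h k. c \<in> A \<Longrightarrow> x \<in> slit_coords c \<Longrightarrow>
           curvature_low (local_L A F c) r j h k x =
             complex_of_real (K (tangent_point A c x)) *
               (fund_tensor (local_L A F c) j r x * fund_tensor (local_L A F c) k h x
                + fund_tensor (local_L A F c) k r x * fund_tensor (local_L A F c) j h x)"
  shows "(purely_hermitian A F \<and>
            (\<exists>\<kappa> :: 'a \<Rightarrow> real. \<forall>(p, v) \<in> slit_tangent_bundle X A. K (p, v) = \<kappa> p)) \<or>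
         (\<not> purely_hermitian A F \<and> (\<forall>x \<in> slit_tangent_bundle X A. K x = 0))"
proof -
  note fc = finsler_chart and cv = curv[unfolded slit_coords_def]
  \<comment> \<open>A fixed nonzero coordinate vector, at which the base function is read off in
    each chart.\<close>
  have e: "axis undefined 1 \<noteq> (0 :: complex^'n)" by (auto simp: axis_eq_0_iff)
  \<comment> \<open>A vector is chosen in each slit fibre; \<open>K_fibre\<close> makes the value
    independent of the choice.\<close>
  define \<kappa> where "\<kappa> p = K (p, SOME v. (p, v) \<in> slit_tangent_bundle X A)" for p
  have K_fibre: "K (p, v) = K (p, w)"
    if pv: "(p, v) \<in> slit_tangent_bundle X A" and pw: "(p, w) \<in> slit_tangent_bundle X A" for p v w
  proof -
    have "p \<in> topspace X" using pv by (auto simp: slit_tangent_bundle_def hol_tangent_bundle_def)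
    then obtain c where c: "c \<in> A" "p \<in> fst c" using charts_cover by blast
    obtain \<eta> where \<eta>: "\<eta> \<noteq> 0" "tangent_point A c (snd c p, \<eta>) = (p, v)"
      using slit_tangent_bundle_cases[OF c pv] by blast
    obtain \<theta> where \<theta>: "\<theta> \<noteq> 0" "tangent_point A c (snd c p, \<theta>) = (p, w)"
      using slit_tangent_bundle_cases[OF c pw] by blast
    have "snd c p \<in> chart_image c" using c by (auto simp: chart_image_def)
    from finsler_chart.kappa_constant_on_fibre[OF fc[OF c(1)] cv[OF c(1)] this \<eta>(1) \<theta>(1)]
    show ?thesis by (simp add: \<eta> \<theta>)
  qed
  have K_eq: "K (p, v) = \<kappa> p" if "(p, v) \<in> slit_tangent_bundle X A" for p v
    unfolding \<kappa>_def by (rule K_fibre[OF that someI[of "\<lambda>v. (p, v) \<in> slit_tangent_bundle X A", OF that]])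
  have K_chart: "K (tangent_point A c (snd c p, \<eta>)) = \<kappa> p" if "c \<in> A" "p \<in> fst c" "\<eta> \<noteq> 0" for c p \<eta>
    using K_eq tangent_point_slit[OF that] by (metis prod.collapse)
  define Z where "Z = {p \<in> topspace X. \<kappa> p = 0}"
  have "openin X Z"
  proof (subst openin_subopen, intro ballI)
    fix p assume p: "p \<in> Z"
    then obtain c where c: "c \<in> A" "p \<in> fst c" using charts_cover unfolding Z_def by blast
    have z: "snd c p \<in> chart_image c" using c by (auto simp: chart_image_def)
    have "K (tangent_point A c (snd c p, axis undefined 1)) = 0"
      using K_chart[OF c e] p by (simp add: Z_def)
    from finsler_chart.kappa_zero_open[OF fc[OF c(1)] cv[OF c(1)] n z e this]
    obtain r where r: "r > 0" "ball (snd c p) r \<subseteq> chart_image c"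
      "\<And>w. w \<in> ball (snd c p) r \<Longrightarrow> K (tangent_point A c (w, axis undefined 1)) = 0"
      by metis
    let ?T = "{q \<in> fst c. snd c q \<in> ball (snd c p) r}"
    have "openin X ?T" by (rule openin_chart_preimage[OF c(1)]) simp
    moreover have "p \<in> ?T" using c r by simp
    moreover have "?T \<subseteq> Z"
    proof
      fix q assume q: "q \<in> ?T"
      then have "\<kappa> q = 0" using r(3)[of "snd c q"] K_chart[OF c(1) _ e, of q] by simp
      then show "q \<in> Z" using q openin_subset[OF chart_domain_open[OF c(1)]] by (auto simp: Z_def)
    qed
    ultimately show "\<exists>T. openin X T \<and> p \<in> T \<and> T \<subseteq> Z" by blast
  qed
  moreover have "openin X (topspace X - Z)"
  proof (subst openin_subopen, intro ballI)
    fix p assume p: "p \<in> topspace X - Z"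
    then obtain c where c: "c \<in> A" "p \<in> fst c" using charts_cover by blast
    have z: "snd c p \<in> chart_image c" using c by (auto simp: chart_image_def)
    \<comment> \<open>The base function in the chart, evaluated along a constant fibre vector; its
      continuity makes the complement of \<open>Z\<close> open.\<close>
    define f where "f w = complex_of_real (K (tangent_point A c (w, axis undefined 1)))" for w
    have "continuous_on (chart_image c \<times> (UNIV - {0})) (\<lambda>x. complex_of_real (K (tangent_point A c x)))"
      by (rule smooth_on_imp_continuous_on[OF finsler_chart.smooth_kappa[OF fc[OF c(1)] cv[OF c(1)]]])
    then have "continuous_on (chart_image c) f"
      unfolding f_def[abs_def]
      by (rule continuous_on_compose2[where f = "\<lambda>w. (w, axis undefined 1)"]) (auto intro!: continuous_intros e)
    then have W: "open {w \<in> chart_image c. f w \<in> - {0}}"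
      using continuous_open_preimage[OF _ chart_image_open[OF c(1)], of f "- {0}"]
      by (simp add: vimage_def Int_def open_Compl)
    let ?T = "{q \<in> fst c. snd c q \<in> {w \<in> chart_image c. f w \<in> - {0}}}"
    have f: "f (snd c q) = \<kappa> q" if "q \<in> fst c" for q
      by (simp add: f_def K_chart[OF c(1) that e])
    have "openin X ?T" by (rule openin_chart_preimage[OF c(1) W])
    moreover have "p \<in> ?T" using c z p by (auto simp: f Z_def)
    moreover have "?T \<subseteq> topspace X - Z"
      using openin_subset[OF chart_domain_open[OF c(1)]] by (auto simp: f Z_def)
    ultimately show "\<exists>T. openin X T \<and> p \<in> T \<and> T \<subseteq> topspace X - Z" by blast
  qed
  ultimately have "Z = {} \<or> Z = topspace X"
    using connected by (auto simp: connected_space_clopen_in closedin_def Z_def)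
  then show ?thesis
  proof
    assume Z: "Z = topspace X"
    have "K (p, v) = 0" if "(p, v) \<in> slit_tangent_bundle X A" for p v
    proof -
      have "p \<in> Z" using that Z by (auto simp: slit_tangent_bundle_def hol_tangent_bundle_def)
      then show ?thesis using K_eq[OF that] by (simp add: Z_def)
    qed
    \<comment> \<open>Vanishing K is compatible with both alternatives, so the metric decides; in
      the Hermitian case the zero function is the witness.\<close>
    then show ?thesis by (cases "purely_hermitian A F") (auto intro!: exI[of _ "\<lambda>_. 0"])
  next
    assume Z: "Z = {}"
    have "purely_hermitian A F"
      unfolding purely_hermitian_def
    proof (intro ballI allI impI)
      fix c i j z \<eta> \<eta>' assume c: "c \<in> A" and S: "(z, \<eta>) \<in> slit_coords c" "(z, \<eta>') \<in> slit_coords c"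
      then have z: "z \<in> chart_image c" and nz: "\<eta> \<noteq> 0" "\<eta>' \<noteq> 0" by (auto simp: slit_coords_def)
      obtain p where p: "p \<in> fst c" "z = snd c p" using z by (auto simp: chart_image_def)
      then have "\<kappa> p \<noteq> 0" using Z openin_subset[OF chart_domain_open[OF c]] by (auto simp: Z_def)
      then have "K (tangent_point A c (z, \<eta>)) \<noteq> 0" using K_chart[OF c p(1) nz(1)] p by simp
      from finsler_chart.g_constant_on_fibre[OF fc[OF c] cv[OF c] z nz this]
      show "fund_tensor (local_L A F c) i j (z, \<eta>) = fund_tensor (local_L A F c) i j (z, \<eta>')" .
    qed
    then show ?thesis using K_eq by blast
  qed
qed

theorem corollary4p6:
  fixes X :: "'a topology"
    and A :: "('a, 2) chart set"
    and F K :: "'a \<times> ('a, 2) tvec \<Rightarrow> real"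
  assumes "complex_finsler_space X A F"
    and "connected_space X"
    and "\<And>c x r j h k. c \<in> A \<Longrightarrow> x \<in> slit_coords c \<Longrightarrow>
           curvature_low (local_L A F c) r j h k x =
             complex_of_real (K (tangent_point A c x)) *
               (fund_tensor (local_L A F c) j r x * fund_tensor (local_L A F c) k h x
                + fund_tensor (local_L A F c) k r x * fund_tensor (local_L A F c) j h x)"
  shows "(purely_hermitian A F \<and>
            (\<exists>\<kappa> :: 'a \<Rightarrow> real. \<forall>(p, v) \<in> slit_tangent_bundle X A. K (p, v) = \<kappa> p)) \<or>
         (\<not> purely_hermitian A F \<and> (\<forall>x \<in> slit_tangent_bundle X A. K x = 0))"
  by (rule complex_finsler_space.constant_curvature_dichotomy[OF assms(1) _ assms(2,3)]) simp_all

end
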